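(* $Q(4) = L(4)$. That is, every winning quantum correlation for the $K_4$-automorphism game is a classical correlation.
   Context: Write $[n]=\{1,\dots,n\}$. In the $K_n$-automorphism game, Alice and Bob receive inputs $i,j\in[n]$ and answer $l,k\in[n]$ respectively (without communicating); they win iff $\delta_{ij}=\delta_{lk}$. A correlation is a function $p:[n]^4\to[0,1]$, written $p(l,k|i,j)$, with $\sum_{l,k}p(l,k|i,j)=1$ for all $i,j$. It is winning if $p(l,k|i,j)=0$ whenever $\delta_{ij}\neq\delta_{lk}$. For $\pi\in S_n$ let $p_\pi(l,k|i,j)=1$ if $l=\pi(i)$ and $k=\pi(j)$, and $0$ otherwise. $L(n)=\operatorname{conv}\{p_\pi:\pi\in S_n\}$ is the set of winning classical correlations for the $K_n$-automorphism game. $Q(n)$ is the set of winning quantum correlations for the $K_n$-automorphism game: winning correlations of the form $p(l,k|i,j)=\psi^*M_{il}N_{jk}\psi$, where $\psi$ is a unit vector in a Hilbert space $\mathcal H$, and $M_{il},N_{jk}\in B(\mathcal H)$ are positive semidefinite operators with $\sum_l M_{il}=\mathbf 1=\sum_k N_{jk}$ for all $i,j$ and $M_{il}N_{jk}=N_{jk}M_{il}$ for all $i,j,l,k$. It is known that $p\in Q(n)$ if and only if there are a unital $C^*$-algebra $\mathcal A$ with a tracial state $\tau$ and a quantum permutation matrix $U=(u_{ij})\in M_n(\mathcal A)$ (i.e. $u_{ij}=u_{ij}^*=u_{ij}^2$ and $\sum_k u_{ik}=\sum_k u_{ki}=\mathbf 1$ for all $i$) such that $p(l,k|i,j)=\tau(u_{il}u_{jk})$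 for all $i,j,l,k\in[n]$. *)

theory Defs
  imports "HOL-Analysis.Analysis"
begin

section \<open>Complex Hilbert spaces\<close>

text \<open>
  A complex Hilbert space is presented as a complete real inner product space (which fixes norm,
  metric and topology) carrying a complex scalar multiplication and a sesquilinear form whose real
  part is the real inner product.  Hence \<open>\<langle>x, x\<rangle> = \<parallel>x\<parallel>\<^sup>2\<close>, and positive definiteness and
  completeness are inherited.  The form is conjugate linear in its first argument, so
  \<open>\<psi>\<^sup>* A \<psi>\<close> is \<open>cinner \<psi> (A \<psi>)\<close>.
\<close>

class chilbert_space = real_inner + complete_space +
  fixes scaleC :: "complex \<Rightarrow> 'a \<Rightarrow> 'a"  (infixr "*\<^sub>C" 75)
    and cinner :: "'a \<Rightarrow> 'a \<Rightarrow> complex"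
  assumes scaleC_add_right: "c *\<^sub>C (x + y) = c *\<^sub>C x + c *\<^sub>C y"
    and scaleC_add_left: "(c + d) *\<^sub>C x = c *\<^sub>C x + d *\<^sub>C x"
    and scaleC_scaleC: "c *\<^sub>C d *\<^sub>C x = (c * d) *\<^sub>C x"
    and scaleC_of_real: "complex_of_real r *\<^sub>C x = r *\<^sub>R x"
    and cinner_commute: "cinner x y = cnj (cinner y x)"
    and cinner_add_right: "cinner x (y + z) = cinner x y + cinner x z"
    and cinner_scaleC_right: "cinner x (c *\<^sub>C y) = c * cinner x y"
    and Re_cinner: "Re (cinner x y) = inner x y"

definition bounded_clinear :: "('h::chilbert_space \<Rightarrow> 'h) \<Rightarrow> bool" where
  "bounded_clinear A \<longleftrightarrow> bounded_linear A \<and> (\<forall>c x. A (c *\<^sub>C x) = c *\<^sub>C A x)"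

text \<open>Over the complex numbers this condition implies self-adjointness.\<close>

definition positive_operator :: "('h::chilbert_space \<Rightarrow> 'h) \<Rightarrow> bool" where
  "positive_operator A \<longleftrightarrow> bounded_clinear A \<and> (\<forall>x. cinner x (A x) \<in> \<real>\<^sub>\<ge>\<^sub>0)"


section \<open>Correlations for the \<open>K\<^sub>n\<close>-automorphism game\<close>

text \<open>
  The set \<open>[n]\<close> is a finite type \<open>'n\<close> with \<open>n\<close> elements, and the component \<open>p $ (l, k, i, j)\<close> is
  \<open>p(l, k | i, j)\<close>: answers first, then questions.
\<close>

type_synonym 'n corr = "real ^ ('n \<times> 'n \<times> 'n \<times> 'n)"

definition correlation :: "'n::finite corr \<Rightarrow> bool" where
  "correlation p \<longleftrightarrow>
     (\<forall>l k i j. 0 \<le> p $ (l, k, i, j) \<and> p $ (l, k, i, j) \<le> 1) \<and>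
     (\<forall>i j. (\<Sum>l\<in>UNIV. \<Sum>k\<in>UNIV. p $ (l, k, i, j)) = 1)"

definition winning :: "'n::finite corr \<Rightarrow> bool" where
  "winning p \<longleftrightarrow> (\<forall>l k i j. (i = j) \<noteq> (l = k) \<longrightarrow> p $ (l, k, i, j) = 0)"

definition perm_corr :: "('n::finite \<Rightarrow> 'n) \<Rightarrow> 'n corr" where
  "perm_corr \<pi> = (\<chi> x. case x of (l, k, i, j) \<Rightarrow> if l = \<pi> i \<and> k = \<pi> j then 1 else 0)"

definition classical_correlations :: "'n::finite corr set" where
  "classical_correlations = convex hull {perm_corr \<pi> | \<pi>. \<pi> permutes UNIV}"

text \<open>
  Existence of a Hilbert space is existence of a type of class \<open>chilbert_space\<close>, which cannot be
  quantified inside a formula.  The set of winning quantum correlations is therefore indexed by the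
  Hilbert space; the set \<open>Q(n)\<close> is the union of \<open>quantum_correlations TYPE('h)\<close> over all such
  types \<open>'h\<close>.
\<close>

definition quantum_correlations :: "'h::chilbert_space itself \<Rightarrow> 'n::finite corr set" where
  "quantum_correlations (H :: 'h itself) =
     {p. correlation p \<and> winning p \<and>
         (\<exists>(\<psi> :: 'h) (M :: 'n \<Rightarrow> 'n \<Rightarrow> 'h \<Rightarrow> 'h) (N :: 'n \<Rightarrow> 'n \<Rightarrow> 'h \<Rightarrow> 'h).
            norm \<psi> = 1 \<and>
            (\<forall>i l. positive_operator (M i l)) \<and>
            (\<forall>j k. positive_operator (N j k)) \<and>
            (\<forall>i x. (\<Sum>l\<in>UNIV. M i l x) = x) \<and>
            (\<forall>j x. (\<Sum>k\<in>UNIV. N j k x) = x) \<and>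
            (\<forall>i j k l. M i l \<circ> N j k = N j k \<circ> M i l) \<and>
            (\<forall>l k i j. complex_of_real (p $ (l, k, i, j)) = cinner \<psi> (M i l (N j k \<psi>))))}"


section \<open>The Hilbert space of square-summable sequences\<close>

typedef ell2 = "{f :: nat \<Rightarrow> complex. summable (\<lambda>n. (cmod (f n))\<^sup>2)}"
  morphisms coord Abs_ell2
  by (rule exI[of _ "\<lambda>_. 0"]) simp

setup_lifting type_definition_ell2

lemma summable_coord: "summable (\<lambda>n. (cmod (coord x n))\<^sup>2)"
  using coord[of x] by simp

lemma square_summable_add:
  assumes "summable (\<lambda>n. (cmod (f n))\<^sup>2)" and "summable (\<lambda>n. (cmod (g n))\<^sup>2)"
  shows "summable (\<lambda>n. (cmod (f n + g n))\<^sup>2)"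
proof (rule summable_comparison_test')
  show "summable (\<lambda>n. 2 * (cmod (f n))\<^sup>2 + 2 * (cmod (g n))\<^sup>2)"
    by (intro summable_add summable_mult assms)
  fix n
  have "(cmod (f n + g n))\<^sup>2 \<le> (cmod (f n) + cmod (g n))\<^sup>2"
    by (intro power_mono norm_triangle_ineq norm_ge_zero)
  also have "\<dots> \<le> 2 * (cmod (f n))\<^sup>2 + 2 * (cmod (g n))\<^sup>2"
    using zero_le_power2[of "cmod (f n) - cmod (g n)"] by (simp add: power2_eq_square algebra_simps)
  finally show "norm ((cmod (f n + g n))\<^sup>2) \<le> 2 * (cmod (f n))\<^sup>2 + 2 * (cmod (g n))\<^sup>2"
    by simp
qed

lemma square_summable_scale:
  assumes "summable (\<lambda>n. (cmod (f n))\<^sup>2)"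
  shows "summable (\<lambda>n. (cmod (c * f n))\<^sup>2)"
  using summable_mult[OF assms, of "(cmod c)\<^sup>2"] by (simp add: norm_mult power_mult_distrib)

lemma summable_cnj_mult:
  assumes "summable (\<lambda>n. (cmod (f n))\<^sup>2)" and "summable (\<lambda>n. (cmod (g n))\<^sup>2)"
  shows "summable (\<lambda>n. cnj (f n) * g n)"
proof (rule summable_comparison_test')
  show "summable (\<lambda>n. (cmod (f n))\<^sup>2 + (cmod (g n))\<^sup>2)"
    by (intro summable_add assms)
  fix n
  have "0 \<le> (cmod (f n) - cmod (g n))\<^sup>2" and "0 \<le> cmod (f n) * cmod (g n)"
    by simp_all
  then show "norm (cnj (f n) * g n) \<le> (cmod (f n))\<^sup>2 + (cmod (g n))\<^sup>2"
    unfolding norm_mult complex_mod_cnj power2_diff by linarith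
qed

lift_definition scaleC_ell2 :: "complex \<Rightarrow> ell2 \<Rightarrow> ell2" is "\<lambda>c f n. c * f n"
  by (rule square_summable_scale)

definition cinner_ell2 :: "ell2 \<Rightarrow> ell2 \<Rightarrow> complex" where
  "cinner_ell2 x y = (\<Sum>n. cnj (coord x n) * coord y n)"

lemma summable_cinner_ell2: "summable (\<lambda>n. cnj (coord x n) * coord y n)"
  by (intro summable_cnj_mult summable_coord)

instantiation ell2 :: real_inner
begin

lift_definition zero_ell2 :: ell2 is "\<lambda>_. 0" by simp

lift_definition plus_ell2 :: "ell2 \<Rightarrow> ell2 \<Rightarrow> ell2" is "\<lambda>f g n. f n + g n"
  by (rule square_summable_add)

lift_definition uminus_ell2 :: "ell2 \<Rightarrow> ell2" is "\<lambda>f n. - f n" by simp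

definition minus_ell2 :: "ell2 \<Rightarrow> ell2 \<Rightarrow> ell2" where "x - y = x + - (y :: ell2)"

definition scaleR_ell2 :: "real \<Rightarrow> ell2 \<Rightarrow> ell2" where
  "r *\<^sub>R x = scaleC_ell2 (complex_of_real r) x"

definition inner_ell2 :: "ell2 \<Rightarrow> ell2 \<Rightarrow> real" where "inner x y = Re (cinner_ell2 x y)"

definition norm_ell2 :: "ell2 \<Rightarrow> real" where "norm x = sqrt (inner x (x :: ell2))"

definition dist_ell2 :: "ell2 \<Rightarrow> ell2 \<Rightarrow> real" where "dist x y = norm (x - (y :: ell2))"

definition sgn_ell2 :: "ell2 \<Rightarrow> ell2" where "sgn x = inverse (norm x) *\<^sub>R (x :: ell2)"

definition uniformity_ell2 :: "(ell2 \<times> ell2) filter" where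
  "uniformity = (INF e\<in>{0<..}. principal {(x, y :: ell2). dist x y < e})"

definition open_ell2 :: "ell2 set \<Rightarrow> bool" where
  "open (U :: ell2 set) = (\<forall>x\<in>U. \<forall>\<^sub>F (x', y) in uniformity. x' = x \<longrightarrow> y \<in> U)"

lemma cinner_ell2_self: "cinner_ell2 x x = complex_of_real (\<Sum>n. (cmod (coord x n))\<^sup>2)"
proof -
  have "cinner_ell2 x x = (\<Sum>n. complex_of_real ((cmod (coord x n))\<^sup>2))"
    unfolding cinner_ell2_def
    by (simp only: complex_norm_square mult.commute[of "cnj _"])
  then show ?thesis
    by (simp only: suminf_of_real[OF summable_coord])
qed

lemma cinner_ell2_commute: "cinner_ell2 x y = cnj (cinner_ell2 y x)"
proof -
  have "(\<lambda>n. cnj (coord y n) * coord x n) sums cinner_ell2 y x"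
    unfolding cinner_ell2_def by (intro summable_sums summable_cinner_ell2)
  then have "(\<lambda>n. cnj (cnj (coord y n) * coord x n)) sums cnj (cinner_ell2 y x)"
    by (simp only: sums_cnj)
  then show ?thesis
    by (simp add: cinner_ell2_def sums_iff mult.commute)
qed

lemma cinner_ell2_add_right: "cinner_ell2 x (y + z) = cinner_ell2 x y + cinner_ell2 x z"
  by (simp add: cinner_ell2_def plus_ell2.rep_eq distrib_left suminf_add summable_cinner_ell2)

lemma cinner_ell2_scaleC_right: "cinner_ell2 x (scaleC_ell2 c y) = c * cinner_ell2 x y"
  by (simp add: cinner_ell2_def scaleC_ell2.rep_eq mult.left_commute suminf_mult
        summable_cinner_ell2)

instance
proof
  fix x y z :: ell2 and r s :: real
  show "x + y + z = x + (y + z)" by transfer (simp add: add.assoc)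
  show "x + y = y + x" by transfer (simp add: add.commute)
  show "0 + x = x" by transfer simp
  show "- x + x = 0" by transfer simp
  show "x - y = x + - y" by (fact minus_ell2_def)
  show "r *\<^sub>R (x + y) = r *\<^sub>R x + r *\<^sub>R y"
    unfolding scaleR_ell2_def by transfer (simp add: distrib_left)
  show "(r + s) *\<^sub>R x = r *\<^sub>R x + s *\<^sub>R x"
    unfolding scaleR_ell2_def by transfer (simp add: distrib_right)
  show "r *\<^sub>R s *\<^sub>R x = (r * s) *\<^sub>R x"
    unfolding scaleR_ell2_def by transfer (simp add: mult.assoc)
  show "1 *\<^sub>R x = x" unfolding scaleR_ell2_def by transfer simp
  show "dist x y = norm (x - y)" by (fact dist_ell2_def)
  show "sgn x = inverse (norm x) *\<^sub>R x" by (fact sgn_ell2_def)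
  show "(uniformity :: (ell2 \<times> ell2) filter) = (INF e\<in>{0<..}. principal {(x, y). dist x y < e})"
    by (fact uniformity_ell2_def)
  show "open U = (\<forall>x\<in>U. \<forall>\<^sub>F (x', y) in uniformity. x' = x \<longrightarrow> y \<in> U)" for U :: "ell2 set"
    by (fact open_ell2_def)
  show inner_comm: "inner a b = inner b a" for a b :: ell2
    unfolding inner_ell2_def by (subst cinner_ell2_commute) simp
  have "inner z (x + y) = inner z x + inner z y"
    by (simp add: inner_ell2_def cinner_ell2_add_right)
  then show "inner (x + y) z = inner x z + inner y z"
    by (simp only: inner_comm[of z])
  have "inner y (r *\<^sub>R x) = r * inner y x"
    by (simp add: inner_ell2_def scaleR_ell2_def cinner_ell2_scaleC_right)
  then show "inner (r *\<^sub>R x) y = r * inner x y"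
    by (simp only: inner_comm[of y])
  show "0 \<le> inner x x"
    by (simp add: inner_ell2_def cinner_ell2_self suminf_nonneg summable_coord)
  show "inner x x = 0 \<longleftrightarrow> x = 0"
  proof -
    have "inner x x = 0 \<longleftrightarrow> (\<forall>n. (cmod (coord x n))\<^sup>2 = 0)"
      unfolding inner_ell2_def cinner_ell2_self Re_complex_of_real
      by (rule suminf_eq_zero_iff[OF summable_coord]) simp
    also have "\<dots> \<longleftrightarrow> x = 0"
      by (auto simp: coord_inject[symmetric] zero_ell2.rep_eq fun_eq_iff)
    finally show ?thesis .
  qed
  show "norm x = sqrt (inner x x)" by (fact norm_ell2_def)
qed

end

lemma norm_ell2_eq: "norm x = sqrt (\<Sum>n. (cmod (coord x n))\<^sup>2)"
  by (simp add: norm_ell2_def inner_ell2_def cinner_ell2_self)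

lemma coord_minus: "coord (x - y) n = coord x n - coord y n"
  unfolding minus_ell2_def plus_ell2.rep_eq uminus_ell2.rep_eq by simp

lemma sum_coord_le_norm: "(\<Sum>n<K. (cmod (coord x n))\<^sup>2) \<le> (norm x)\<^sup>2"
  by (simp add: norm_ell2_eq suminf_nonneg summable_coord sum_le_suminf)

lemma cmod_coord_le_norm: "cmod (coord x n) \<le> norm x"
proof -
  have "(cmod (coord x n))\<^sup>2 \<le> (\<Sum>k<Suc n. (cmod (coord x k))\<^sup>2)"
    by (rule member_le_sum) auto
  also have "\<dots> \<le> (norm x)\<^sup>2" by (rule sum_coord_le_norm)
  finally show ?thesis by (rule power2_le_imp_le) simp
qed

instance ell2 :: complete_space
proof
  fix X :: "nat \<Rightarrow> ell2"
  assume X: "Cauchy X"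
  have "Cauchy (\<lambda>m. coord (X m) k)" for k
  proof (rule metric_CauchyI)
    fix e :: real assume "e > 0"
    then obtain m0 where m0: "\<And>m m'. m \<ge> m0 \<Longrightarrow> m' \<ge> m0 \<Longrightarrow> dist (X m) (X m') < e"
      using metric_CauchyD[OF X] by blast
    have "dist (coord (X m) k) (coord (X m') k) < e" if "m \<ge> m0" "m' \<ge> m0" for m m'
      using m0[OF that] cmod_coord_le_norm[of "X m - X m'" k]
      by (simp add: dist_norm coord_minus)
    then show "\<exists>m0. \<forall>m\<ge>m0. \<forall>m'\<ge>m0. dist (coord (X m) k) (coord (X m') k) < e"
      by blast
  qed
  then have "\<exists>l. (\<lambda>m. coord (X m) k) \<longlonglongrightarrow> l" for k
    by (simp add: Cauchy_convergent_iff convergent_def)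
  then obtain f where f: "\<And>k. (\<lambda>m. coord (X m) k) \<longlonglongrightarrow> f k"
    by metis
  have tail: "\<exists>m0. \<forall>m\<ge>m0. \<forall>K. (\<Sum>k<K. (cmod (coord (X m) k - f k))\<^sup>2) \<le> e\<^sup>2" if "e > 0" for e
  proof -
    obtain m0 where m0: "\<And>m m'. m \<ge> m0 \<Longrightarrow> m' \<ge> m0 \<Longrightarrow> dist (X m) (X m') < e"
      using metric_CauchyD[OF X \<open>e > 0\<close>] by blast
    have "(\<Sum>k<K. (cmod (coord (X m) k - f k))\<^sup>2) \<le> e\<^sup>2" if "m \<ge> m0" for m K
    proof (rule tendsto_upperbound)
      show "(\<lambda>m'. \<Sum>k<K. (cmod (coord (X m) k - coord (X m') k))\<^sup>2)
              \<longlonglongrightarrow> (\<Sum>k<K. (cmod (coord (X m) k - f k))\<^sup>2)"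
        by (intro tendsto_intros f)
      have "(\<Sum>k<K. (cmod (coord (X m) k - coord (X m') k))\<^sup>2) \<le> e\<^sup>2" if "m' \<ge> m0" for m'
      proof -
        have "(\<Sum>k<K. (cmod (coord (X m) k - coord (X m') k))\<^sup>2) \<le> (norm (X m - X m'))\<^sup>2"
          using sum_coord_le_norm[where x = "X m - X m'" and K = K] by (simp add: coord_minus)
        also have "\<dots> \<le> e\<^sup>2"
          using m0[OF \<open>m \<ge> m0\<close> that] by (intro power_mono) (simp_all add: dist_norm)
        finally show ?thesis .
      qed
      then show "\<forall>\<^sub>F m' in sequentially. (\<Sum>k<K. (cmod (coord (X m) k - coord (X m') k))\<^sup>2) \<le> e\<^sup>2"
        unfolding eventually_sequentially by blast
    qed simp
    then show ?thesis by blast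
  qed
  have diff: "summable (\<lambda>k. (cmod (coord (X m) k - f k))\<^sup>2)"
    if "\<forall>K. (\<Sum>k<K. (cmod (coord (X m) k - f k))\<^sup>2) \<le> e\<^sup>2" for m e
    using that by (intro summableI_nonneg_bounded[where x = "e\<^sup>2"]) auto
  obtain m1 where "\<forall>K. (\<Sum>k<K. (cmod (coord (X m1) k - f k))\<^sup>2) \<le> 1\<^sup>2"
    using tail[OF zero_less_one] by blast
  then have "summable (\<lambda>k. (cmod (coord (X m1) k - f k))\<^sup>2)"
    by (rule diff)
  from square_summable_add[OF square_summable_scale[OF this, of "-1"] summable_coord[of "X m1"]]
  have "summable (\<lambda>k. (cmod (f k))\<^sup>2)" by simp
  then have L: "coord (Abs_ell2 f) = f" by (simp add: Abs_ell2_inverse)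
  have "X \<longlonglongrightarrow> Abs_ell2 f"
  proof (rule metric_LIMSEQ_I)
    fix r :: real assume "r > 0"
    then obtain m0 where m0: "\<And>m K. m \<ge> m0 \<Longrightarrow> (\<Sum>k<K. (cmod (coord (X m) k - f k))\<^sup>2) \<le> (r/2)\<^sup>2"
      using tail[of "r/2"] by auto
    have "dist (X m) (Abs_ell2 f) < r" if "m \<ge> m0" for m
    proof -
      have "(\<Sum>k. (cmod (coord (X m) k - f k))\<^sup>2) \<le> (r/2)\<^sup>2"
        by (rule suminf_le_const[OF diff m0]) (use m0 that in blast)+
      then have "dist (X m) (Abs_ell2 f) \<le> sqrt ((r/2)\<^sup>2)"
        by (simp only: dist_norm norm_ell2_eq coord_minus L real_sqrt_le_iff)
      also have "\<dots> < r" using \<open>r > 0\<close> by simp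
      finally show ?thesis .
    qed
    then show "\<exists>m0. \<forall>m\<ge>m0. dist (X m) (Abs_ell2 f) < r" by blast
  qed
  then show "convergent X" by (rule convergentI)
qed

instantiation ell2 :: chilbert_space
begin

definition scaleC_ell2_inst: "c *\<^sub>C x = scaleC_ell2 c x"

definition cinner_ell2_inst: "cinner x y = cinner_ell2 x y"

instance
proof
  fix x y z :: ell2 and c d :: complex and r :: real
  show "c *\<^sub>C (x + y) = c *\<^sub>C x + c *\<^sub>C y"
    unfolding scaleC_ell2_inst by transfer (simp add: distrib_left)
  show "(c + d) *\<^sub>C x = c *\<^sub>C x + d *\<^sub>C x"
    unfolding scaleC_ell2_inst by transfer (simp add: distrib_right)
  show "c *\<^sub>C d *\<^sub>C x = (c * d) *\<^sub>C x"
    unfolding scaleC_ell2_inst by transfer (simp add: mult.assoc)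
  show "complex_of_real r *\<^sub>C x = r *\<^sub>R x"
    by (simp add: scaleC_ell2_inst scaleR_ell2_def)
  show "cinner x y = cnj (cinner y x)"
    unfolding cinner_ell2_inst by (rule cinner_ell2_commute)
  show "cinner x (y + z) = cinner x y + cinner x z"
    by (simp add: cinner_ell2_inst cinner_ell2_add_right)
  show "cinner x (c *\<^sub>C y) = c * cinner x y"
    by (simp add: cinner_ell2_inst scaleC_ell2_inst cinner_ell2_scaleC_right)
  show "Re (cinner x y) = inner x y"
    by (simp add: cinner_ell2_inst inner_ell2_def)
qed

end

end

theory Submission
  imports Defs
begin

text \<open>
  From the positivity and contraction properties of the measurement operators and the winning
  conditions one gets \<open>M i l \<psi> = N i l \<psi>\<close>, and on the closed span \<open>K\<close> of
  \<open>{n \<psi> | n commutes with all M i l}\<close> the operators \<open>M i l\<close> are the entries \<open>u i l\<close> of a quantum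
  permutation matrix for which \<open>\<tau> y = \<langle>\<psi>, y \<psi>\<rangle>\<close> is tracial; thus
  \<open>p(l, k | i, j) = \<tau> (u i l * u j k)\<close>.

  The numbers \<open>w \<pi> = \<tau> (u 1 (\<pi> 1) * u 2 (\<pi> 2) * u 3 (\<pi> 3))\<close> satisfy \<open>p = \<Sum>\<pi>. w \<pi> * p_\<pi>\<close>, and this
  remains true when a multiple of the sign character is added to \<open>w\<close>. Such a shift makes all
  weights nonnegative as soon as \<open>w \<sigma> + w \<rho> \<ge> 0\<close> whenever \<open>\<sigma>\<close> is even and \<open>\<rho>\<close> is odd. If \<open>\<rho>\<close> and
  \<open>\<sigma>\<close> differ by a transposition, the sum is one of the numbers \<open>p(l, k | i, j)\<close>. If they differ by
  a 4-cycle, it is a quadratic expression in the nine Fourier coefficients \<open>a i j\<close> of \<open>u\<close> over the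
  Klein group. These satisfy the relations of the twisted \<open>SO(3)\<close>: they anticommute within rows
  and columns and commute otherwise, their squares are central and bistochastic, and each is a
  permanent-like 2 by 2 minor of the others. An element \<open>y\<close> anticommuting with the other two
  entries of the row of \<open>a i j\<close> has \<open>\<tau> y = \<tau> (E y)\<close>, where \<open>E = lim (a i j)^(2 m)\<close> is a central
  projection. Inserting these projections turns the quadratic expression into a sum of squares.
\<close>

section \<open>Magic unitaries of size four\<close>

text \<open>Twice an entry is a sum of two reflections, so quadratic relations between entries first
  appear multiplied by 4; this lemma removes the factor.\<close>

lemma double_double_eq_zero:
  assumes "y + y + (y + y) = (0 :: 'r::real_vector)" shows "y = 0"
  using assms by (simp only: scaleR_2[symmetric]) simp

lemma minus_eq_sum:
  assumes "x + y + z + w = (0 :: 'r::ab_group_add)"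
  shows "- w = x + y + z" "- z = x + y + w"
proof -
  show "- w = x + y + z" by (rule minus_unique) (use assms in \<open>simp add: add_ac\<close>)
  show "- z = x + y + w" by (rule minus_unique) (use assms in \<open>simp add: add_ac\<close>)
qed

lemma UNIV_4_eq:
  assumes "distinct [a, b, c, d :: 4]" shows "UNIV = {a, b, c, d}"
proof -
  have "card {a, b, c, d} = CARD(4)" using assms by simp
  then show ?thesis by (metis card_subset_eq finite subset_UNIV)
qed

lemma distinct_extend:
  assumes "c \<noteq> (j :: 4)" obtains l n where "distinct [c, j, l, n]"
proof -
  have "card (UNIV - {c, j}) = 2" using assms by (simp add: card_Diff_subset)
  then obtain l n where "UNIV - {c, j} = {l, n}" "l \<noteq> n" by (auto simp: card_2_iff)
  then have "distinct [c, j, l, n]" using assms by auto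
  then show thesis by (rule that)
qed

lemma sum_UNIV_4:
  assumes "distinct [a, b, c, d :: 4]"
  shows "sum f UNIV = f a + f b + f c + (f d :: 'r::comm_monoid_add)"
  using assms by (simp add: UNIV_4_eq[OF assms] add.assoc)

text \<open>A quantum permutation matrix over a ring without involution. For projections in a
  C*-algebra orthogonality within rows and columns follows from the sums; here it is part of the
  definition.\<close>

definition magic :: "(4 \<Rightarrow> 4 \<Rightarrow> 'r::real_algebra_1) \<Rightarrow> bool" where
  "magic u \<longleftrightarrow> (\<forall>i l. u i l * u i l = u i l) \<and>
     (\<forall>i l k. l \<noteq> k \<longrightarrow> u i l * u i k = 0) \<and> (\<forall>i j l. i \<noteq> j \<longrightarrow> u i l * u j l = 0) \<and>
     (\<forall>i. sum (u i) UNIV = 1) \<and> (\<forall>l. (\<Sum>i\<in>UNIV. u i l) = 1)"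

lemma magic_transpose: "magic u \<Longrightarrow> magic (\<lambda>i l. u l i)"
  by (simp add: magic_def)

text \<open>
  With the base row \<open>r\<close> and the base column \<open>c\<close> as neutral elements, the rows and the columns are
  identified with the Klein four-group and its dual; \<open>entry u r c i j\<close> is the coefficient
  \<open>(\<Sum>g h. \<chi> i g * \<chi> j h * u g h) / 4\<close>, where \<open>\<chi> i\<close> is the character equal to 1 exactly at \<open>r\<close> and
  \<open>i\<close>. The row and column sums of \<open>u\<close> reduce it to four entries.
\<close>

definition entry :: "(4 \<Rightarrow> 4 \<Rightarrow> 'r::real_algebra_1) \<Rightarrow> 4 \<Rightarrow> 4 \<Rightarrow> 4 \<Rightarrow> 4 \<Rightarrow> 'r" where
  "entry u r c i j = u r c + u r j + u i c + u i j - 1"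

lemma entry_transpose: "entry (\<lambda>i l. u l i) c r j i = entry u r c i j"
  by (simp add: entry_def add_ac)

text \<open>For \<open>j \<noteq> c\<close> this is the sum of row \<open>g\<close> against the
  character that is 1 at \<open>c\<close> and \<open>j\<close> and -1 elsewhere; the row sum 1
  eliminates the other two columns.\<close>

definition reflection :: "(4 \<Rightarrow> 4 \<Rightarrow> 'r::real_algebra_1) \<Rightarrow> 4 \<Rightarrow> 4 \<Rightarrow> 4 \<Rightarrow> 'r" where
  "reflection u c g j = u g c + u g j + (u g c + u g j) - 1"

lemma entry_reflection: "entry u r c i j + entry u r c i j = reflection u c r j + reflection u c i
    j"
  by (simp add: entry_def reflection_def algebra_simps)

lemma reflection_square:
  assumes "magic u" "j \<noteq> c" shows "reflection u c g j * reflection u c g j = 1"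
  using assms by (simp add: magic_def reflection_def algebra_simps)

text \<open>Row \<open>g\<close> consists of orthogonal idempotents with sum 1, so sums against
  characters multiply as the characters do, and the product of the characters of \<open>j\<close>
  and \<open>l\<close> is that of \<open>n\<close>.\<close>

lemma reflection_mult:
  assumes "magic u" "distinct [c, j, l, n]" shows "reflection u c g j * reflection u c g l =
      reflection u c g n"
proof -
  have 1: "u g n = 1 - u g c - u g j - u g l"
    using assms sum_UNIV_4[OF assms(2), of "u g"] by (simp add: magic_def algebra_simps)
  have neq: "j \<noteq> c" "l \<noteq> c" "l \<noteq> j" using assms(2) by auto
  have "u g c * u g c = u g c" "u g c * u g l = 0" "u g j * u g c = 0" "u g j * u g l = 0"
    using assms(1) neq by (auto simp: magic_def)
  then show ?thesis
    unfolding reflection_def 1 by (simp add: algebra_simps)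
qed

lemma reflection_sum:
  assumes "magic u" "distinct [r, i, k, m]"
  shows "reflection u c r j + reflection u c i j + reflection u c k j + reflection u c m j = 0"
proof -
  have "(u r c + u i c + u k c + u m c) = 1" "(u r j + u i j + u k j + u m j) = 1"
    using assms sum_UNIV_4[OF assms(2), of "\<lambda>i. u i c"] sum_UNIV_4[OF assms(2), of "\<lambda>i. u i j"]
    by (simp_all add: magic_def)
  then have 2: "u m c = 1 - u r c - u i c - u k c" "u m j = 1 - u r j - u i j - u k j"
    by (simp_all add: algebra_simps)
  show ?thesis unfolding reflection_def 2 by (simp add: algebra_simps)
qed

text \<open>The four reflections of a column pair have square 1 and sum 0. Expanding
  \<open>sm * sm = 1\<close> with \<open>- sm = sr + si + sk\<close> says that
  \<open>sr + si\<close> and \<open>sr + sk\<close>, the doubled entries, anticommute.\<close>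

lemma entry_col_anticommute:
  assumes "magic u" "distinct [r, i, k, m]" "j \<noteq> c"
  shows "entry u r c k j * entry u r c i j = - (entry u r c i j * entry u r c k j)"
proof -
  define sr si sk sm where "sr = reflection u c r j" and "si = reflection u c i j"
    and "sk = reflection u c k j" and "sm = reflection u c m j"
  note s_def = sr_def si_def sk_def sm_def
  have sq: "sr * sr = 1" "si * si = 1" "sk * sk = 1" "sm * sm = 1"
    unfolding s_def by (rule reflection_square[OF assms(1,3)])+
  have "- sm = sr + si + sk"
    using reflection_sum[OF assms(1,2), of c j] unfolding s_def by (simp add: minus_eq_sum)
  then have "(sr + si + sk) * (sr + si + sk) = 1"
    using sq(4) minus_mult_minus[of sm sm] by simp
  then have 0: "(sr + sk) * (sr + si) + (sr + si) * (sr + sk) = 0"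
    by (simp add: algebra_simps sq)
  let ?a = "entry u r c i j" and ?b = "entry u r c k j"
  have a: "?a + ?a = sr + si" "?b + ?b = sr + sk"
    unfolding entry_reflection s_def by simp_all
  have "?b * ?a + ?a * ?b = 0"
    by (rule double_double_eq_zero) (use 0[folded a] in \<open>simp add: algebra_simps\<close>)
  then show ?thesis by (simp add: add_eq_0_iff2)
qed

text \<open>This is multiplicativity \<open>sm * tm = wm\<close> in row \<open>m\<close>: both
  factors are replaced by minus the sum over the other three rows, where multiplicativity applies to
  the products within one row.\<close>

lemma entry_minor:
  assumes "magic u" "distinct [r, i, k, m]" "distinct [c, j, l, n]"
  shows "entry u r c i j * entry u r c k l + entry u r c k j * entry u r c i l = entry u r c m n"
proof -
  define sr si sk sm where "sr = reflection u c r j" and "si = reflection u c i j"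
    and "sk = reflection u c k j" and "sm = reflection u c m j"
  define tr ti tk tm where "tr = reflection u c r l" and "ti = reflection u c i l"
    and "tk = reflection u c k l" and "tm = reflection u c m l"
  define wr wi wk wm where "wr = reflection u c r n" and "wi = reflection u c i n"
    and "wk = reflection u c k n" and "wm = reflection u c m n"
  note s_def = sr_def si_def sk_def sm_def tr_def ti_def tk_def tm_def wr_def wi_def wk_def wm_def
  have st: "sr * tr = wr" "si * ti = wi" "sk * tk = wk" "sm * tm = wm"
    unfolding s_def by (rule reflection_mult[OF assms(1,3)])+
  have "- sm = sr + si + sk" "- tm = tr + ti + tk" and w: "- wm = wr + wi + wk"
    using reflection_sum[OF assms(1,2), of c j] reflection_sum[OF assms(1,2), of c l]
      reflection_sum[OF assms(1,2), of c n] unfolding s_def by (simp_all add: minus_eq_sum)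
  then have "(sr + si + sk) * (tr + ti + tk) = wm"
    using st(4) minus_mult_minus[of sm tm] by simp
  then have 0: "(sr + si) * (tr + tk) + (sr + sk) * (tr + ti) = wr + wm + (wr + wm)"
  proof -
    have "wr + wi + wk + (sr * ti + sr * tk + si * tr + si * tk + sk * tr + sk * ti) = wm"
      using \<open>(sr + si + sk) * (tr + ti + tk) = wm\<close> by (simp add: algebra_simps st)
    then have "sr * ti + sr * tk + si * tr + si * tk + sk * tr + sk * ti = wm + wm"
      unfolding w[symmetric] by (simp only: neg_eq_iff_add_eq_0 algebra_simps) (simp add:
          algebra_simps)
    then show ?thesis by (simp add: algebra_simps st)
  qed
  let ?a = "entry u r c i j" and ?b = "entry u r c k l"
    and ?a' = "entry u r c k j" and ?b' = "entry u r c i l" and ?d = "entry u r c m n"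
  have a: "?a + ?a = sr + si" "?b + ?b = tr + tk" "?a' + ?a' = sr + sk" "?b' + ?b' = tr + ti"
     "?d + ?d = wr + wm"
    unfolding entry_reflection s_def by simp_all
  have "?a * ?b + ?a' * ?b' - ?d = 0"
    by (rule double_double_eq_zero) (use 0[folded a] in \<open>simp add: algebra_simps\<close>)
  then show ?thesis by simp
qed

lemma entry_col_squares:
  assumes "magic u" "distinct [r, i, k, m]" "j \<noteq> c"
  shows "entry u r c i j * entry u r c i j + entry u r c k j * entry u r c k j
    + entry u r c m j * entry u r c m j = 1"
proof -
  define sr si sk sm where "sr = reflection u c r j" and "si = reflection u c i j"
    and "sk = reflection u c k j" and "sm = reflection u c m j"
  note s_def = sr_def si_def sk_def sm_def
  have sq: "sr * sr = 1" "si * si = 1" "sk * sk = 1" "sm * sm = 1"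
    unfolding s_def by (rule reflection_square[OF assms(1,3)])+
  have s: "sm = - (sr + si + sk)"
    using reflection_sum[OF assms(1,2), of c j] unfolding s_def by (simp add: add_eq_0_iff)
  have 0: "(sr + si) * (sr + si) + (sr + sk) * (sr + sk) + (sr + sm) * (sr + sm) = 1 + 1 + (1 + 1)"
    using sq(4) unfolding s by (simp add: algebra_simps sq(1-3))
  let ?a = "entry u r c i j" and ?b = "entry u r c k j" and ?d = "entry u r c m j"
  have a: "?a + ?a = sr + si" "?b + ?b = sr + sk" "?d + ?d = sr + sm"
    unfolding entry_reflection s_def by simp_all
  have "?a * ?a + ?b * ?b + ?d * ?d - 1 = 0"
    by (rule double_double_eq_zero) (use 0[folded a] in \<open>simp add: algebra_simps\<close>)
  then show ?thesis by simp
qed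

lemma entry_row_anticommute:
  assumes "magic u" "distinct [c, j, l, n]" "i \<noteq> r"
  shows "entry u r c i l * entry u r c i j = - (entry u r c i j * entry u r c i l)"
  using entry_col_anticommute[OF magic_transpose[OF assms(1)] assms(2,3)]
  by (simp only: entry_transpose[of u])

lemma entry_row_squares:
  assumes "magic u" "distinct [c, j, l, n]" "i \<noteq> r"
  shows "entry u r c i j * entry u r c i j + entry u r c i l * entry u r c i l + entry u r c i n *
      entry u r c i n = 1"
  using entry_col_squares[OF magic_transpose[OF assms(1)] assms(2,3)]
  by (simp only: entry_transpose[of u])

lemma entry_minor':
  assumes "magic u" "distinct [r, i, k, m]" "distinct [c, j, l, n]"
  shows "entry u r c i j * entry u r c k l + entry u r c i l * entry u r c k j = entry u r c m n"
  using entry_minor[OF magic_transpose[OF assms(1)] assms(3,2)]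
  by (simp only: entry_transpose[of u])

text \<open>\<open>entry_minor\<close> and \<open>entry_minor'\<close> differ only in the order of
  the factors of one product. Comparing them, with \<open>j\<close> and \<open>l\<close> exchanged
  in the first, leaves the commutator.\<close>

lemma entry_commute:
  assumes "magic u" "distinct [r, i, k, m]" "distinct [c, j, l, n]"
  shows "entry u r c k l * entry u r c i j = entry u r c i j * entry u r c k l"
proof -
  have "distinct [c, l, j, n]" using assms(3) by auto
  have "entry u r c i l * entry u r c k j + entry u r c k l * entry u r c i j
      = entry u r c i l * entry u r c k j + entry u r c i j * entry u r c k l"
    unfolding entry_minor[OF assms(1,2) \<open>distinct [c, l, j, n]\<close>]
      entry_minor'[OF assms, symmetric] by (rule add.commute)
  then show ?thesis by (rule add_left_imp_eq)
qed

section \<open>Permutations of four points\<close>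

abbreviation perms4 :: "(4 \<Rightarrow> 4) set" where "perms4 \<equiv> {\<pi>. \<pi> permutes UNIV}"

lemma finite_perms4: "finite perms4"
  by (rule finite_permutations) simp

lemma perms4_permutation: "\<pi> \<in> perms4 \<Longrightarrow> permutation \<pi>"
  unfolding permutation_permutes by (auto intro: exI[of _ UNIV])

lemma perms4_inject: "\<pi> \<in> perms4 \<Longrightarrow> \<pi> i = \<pi> j \<longleftrightarrow> i = j"
  by (auto dest: permutes_inj injD)

lemma transpose_permutes_UNIV: "Transposition.transpose a b permutes UNIV"
  by (simp add: permutes_swap_id)

lemma perms4_transpose: "\<pi> \<in> perms4 \<Longrightarrow> \<pi> \<circ> Transposition.transpose a b \<in> perms4"
  by (simp add: permutes_compose transpose_permutes_UNIV)

lemma perms4_eqI: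
  assumes "distinct [i, j, a, b :: 4]" "\<pi> i = \<sigma> i" "\<pi> j = \<sigma> j" "\<pi> a = \<sigma> a" "\<pi> b = \<sigma> b"
  shows "\<pi> = \<sigma>"
proof
  fix x show "\<pi> x = \<sigma> x" using UNIV_4_eq[OF assms(1)] assms by (cases "x = i \<or> x = j \<or> x = a") auto
qed

lemma distinct_values:
  assumes "\<pi> \<in> perms4" "distinct [i, j, a, b]" shows "distinct [\<pi> i, \<pi> j, \<pi> a, \<pi> b]"
  using assms by (simp add: perms4_inject)

lemma perms4_two_values:
  assumes "distinct [i, j, a, b]" "l \<noteq> k"
  obtains \<sigma> where "\<sigma> \<in> perms4" "\<sigma> i = l" "\<sigma> j = k"
    "{\<pi> \<in> perms4. \<pi> i = l \<and> \<pi> j = k} = {\<sigma>, \<sigma> \<circ> Transposition.transpose a b}"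
    "\<sigma> \<noteq> \<sigma> \<circ> Transposition.transpose a b"
proof -
  \<comment> \<open>The first transposition sends \<open>i\<close> to \<open>l\<close> and
    \<open>j\<close> to \<open>m\<close>; the second sends \<open>m\<close> to \<open>k\<close> and
    fixes \<open>l\<close>, because \<open>m\<close> and \<open>k\<close> both differ from
    \<open>l\<close>.\<close>
  define m where "m = Transposition.transpose i l j"
  define \<sigma> where "\<sigma> = Transposition.transpose m k \<circ> Transposition.transpose i l"
  have ml: "m \<noteq> l" using assms(1) unfolding m_def Transposition.transpose_def by auto
  have \<sigma>: "\<sigma> \<in> perms4" "\<sigma> i = l" "\<sigma> j = k"
    unfolding \<sigma>_def using ml assms(2) by (simp_all add: permutes_compose transpose_permutes_UNIV
        m_def[symmetric])
  have other: "\<pi> = \<sigma> \<or> \<pi> = \<sigma> \<circ> Transposition.transpose a b"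
    if \<pi>: "\<pi> \<in> perms4" "\<pi> i = l" "\<pi> j = k" for \<pi>
  proof -
    have "distinct [l, k, \<pi> a, \<pi> b]" "distinct [l, k, \<sigma> a, \<sigma> b]"
      using distinct_values[OF \<pi>(1) assms(1)] distinct_values[OF \<sigma>(1) assms(1)] \<pi> \<sigma> by simp_all
    moreover have "\<pi> a \<in> {l, k, \<sigma> a, \<sigma> b}" "\<pi> b \<in> {l, k, \<sigma> a, \<sigma> b}"
      using UNIV_4_eq[OF calculation(2)] by blast+
    ultimately have "\<pi> a = \<sigma> a \<and> \<pi> b = \<sigma> b \<or> \<pi> a = \<sigma> b \<and> \<pi> b = \<sigma> a" by auto
    then show ?thesis
      using perms4_eqI[OF assms(1), of \<pi> \<sigma>] perms4_eqI[OF assms(1), of \<pi>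
          "\<sigma> \<circ> Transposition.transpose a b"] \<pi> \<sigma> assms(1)
      by (auto simp: Transposition.transpose_def)
  qed
  have "(\<sigma> \<circ> Transposition.transpose a b) a \<noteq> \<sigma> a"
    using assms(1) \<sigma>(1) by (auto simp: perms4_inject)
  then have "\<sigma> \<noteq> \<sigma> \<circ> Transposition.transpose a b" by metis
  moreover have "{\<pi> \<in> perms4. \<pi> i = l \<and> \<pi> j = k} = {\<sigma>, \<sigma> \<circ> Transposition.transpose a b}"
    using other \<sigma> perms4_transpose[OF \<sigma>(1), of a b] assms(1)
        by (auto simp: Transposition.transpose_def)
  ultimately show thesis using \<sigma> that by blast
qed

text \<open>Two prescribed values leave exactly two permutations, whose weights are added by
  \<open>edge\<close>. The case \<open>i = j\<close> follows by summing over the value at a second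
  point. The general weight \<open>w\<close> allows the lemma to serve both the original weights and
  those shifted by the sign character.\<close>

lemma two_values_sum:
  fixes w :: "(4 \<Rightarrow> 4) \<Rightarrow> real" and q :: "4 \<Rightarrow> 4 \<Rightarrow> 4 \<Rightarrow> 4 \<Rightarrow> real"
  assumes edge: "\<And>\<pi> i j a b. \<pi> \<in> perms4 \<Longrightarrow> distinct [i, j, a, b] \<Longrightarrow>
      w \<pi> + w (\<pi> \<circ> Transposition.transpose a b) = q i (\<pi> i) j (\<pi> j)"
    and row: "\<And>i l k. l \<noteq> k \<Longrightarrow> q i l i k = 0" and col: "\<And>i j l. i \<noteq> j \<Longrightarrow> q i l j l = 0"
    and marginal: "\<And>i l j. (\<Sum>k\<in>UNIV. q i l j k) = q i l i l"
  shows "q i l j k = (\<Sum>\<pi>\<in>perms4. w \<pi> * of_bool (\<pi> i = l \<and> \<pi> j = k))"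
proof -
  have 1: "q i l j k = (\<Sum>\<pi>\<in>perms4. w \<pi> * of_bool (\<pi> i = l \<and> \<pi> j = k))" if "i \<noteq> j" for i j k
  proof (cases "l = k")
    case True
    have "w \<pi> * of_bool (\<pi> i = l \<and> \<pi> j = k) = 0" if "\<pi> \<in> perms4" for \<pi>
      using perms4_inject[OF that, of i j] True \<open>i \<noteq> j\<close> by auto
    then show ?thesis using col[OF that] True by (simp only: sum.neutral_const cong: sum.cong)
  next
    case False
    obtain a b where d: "distinct [i, j, a, b]" using \<open>i \<noteq> j\<close> by (metis distinct_extend)
    obtain \<sigma> where \<sigma>: "\<sigma> \<in> perms4" "\<sigma> i = l" "\<sigma> j = k"
        "{\<pi> \<in> perms4. \<pi> i = l \<and> \<pi> j = k} = {\<sigma>, \<sigma> \<circ> Transposition.transpose a b}"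
        "\<sigma> \<noteq> \<sigma> \<circ> Transposition.transpose a b"
      using perms4_two_values[OF d False] .
    have "(\<Sum>\<pi>\<in>perms4. w \<pi> * of_bool (\<pi> i = l \<and> \<pi> j = k)) = (\<Sum>\<pi>\<in>{\<pi> \<in> perms4. \<pi> i = l \<and> \<pi> j = k}. w
        \<pi>)"
      by (rule sum.mono_neutral_cong_right[OF finite_perms4]) auto
    then show ?thesis using edge[OF \<sigma>(1) d] \<sigma>(2,3,5) unfolding \<sigma>(4) by simp
  qed
  show ?thesis
  proof (cases "i = j")
    case False then show ?thesis by (rule 1)
  next
    case True
    obtain j' where j': "i \<noteq> j'" by (metis distinct_extend distinct_length_2_or_more zero_neq_one)
    have "q i l i l = (\<Sum>k\<in>UNIV. \<Sum>\<pi>\<in>perms4. w \<pi> * of_bool (\<pi> i = l \<and> \<pi> j' = k))"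
      unfolding marginal[of i l j', symmetric] using 1[OF j'] by simp
    also have "\<dots> = (\<Sum>\<pi>\<in>perms4. \<Sum>k\<in>UNIV. w \<pi> * of_bool (\<pi> i = l \<and> \<pi> j' = k))"
      by (rule sum.swap)
    also have "\<dots> = (\<Sum>\<pi>\<in>perms4. w \<pi> * of_bool (\<pi> i = l))"
    proof (rule sum.cong[OF refl])
      fix \<pi> :: "4 \<Rightarrow> 4"
      have "(\<Sum>k\<in>UNIV. w \<pi> * of_bool (\<pi> i = l \<and> \<pi> j' = k)) = (\<Sum>k\<in>UNIV.
          if \<pi> j' = k then w \<pi> * of_bool (\<pi> i = l) else 0)"
        by (rule sum.cong) auto
      then show "(\<Sum>k\<in>UNIV. w \<pi> * of_bool (\<pi> i = l \<and> \<pi> j' = k)) = w \<pi> * of_bool (\<pi> i = l)" by simp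
    qed
    finally have 2: "q i l i l = (\<Sum>\<pi>\<in>perms4. w \<pi> * of_bool (\<pi> i = l))" .
    show ?thesis
    proof (cases "l = k")
      case True then show ?thesis using 2 \<open>i = j\<close> by simp
    next
      case False
      then have "w \<pi> * of_bool (\<pi> i = l \<and> \<pi> j = k) = 0" for \<pi> using \<open>i = j\<close> by auto
      then show ?thesis using row[OF False] \<open>i = j\<close> by (simp only: sum.neutral_const cong: sum.cong)
    qed
  qed
qed

text \<open>The orbit of a moved point determines the cycle type; 3-cycles and double transpositions
  are products of two transpositions, hence even. The labels make \<open>r\<close> and
  \<open>i\<close> opposite points of the 4-cycle.\<close>

lemma odd_perms4_cases:
  assumes "\<kappa> \<in> perms4" "\<not> evenperm \<kappa>"
  obtains (transposition) a b where "a \<noteq> b" "\<kappa> = Transposition.transpose a b"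
    | (cycle) r i k m where "distinct [r, i, k, m]" "\<kappa> r = m" "\<kappa> m = i" "\<kappa> i = k" "\<kappa> k = r"
proof -
  have inj: "\<kappa> x = \<kappa> y \<longleftrightarrow> x = y" for x y by (rule perms4_inject[OF assms(1)])
  have even2: "evenperm (Transposition.transpose a b \<circ> Transposition.transpose a' b')"
    if "a \<noteq> b" "a' \<noteq> b'" for a b a' b' :: 4
    using that by (simp add: evenperm_comp permutation_swap_id evenperm_swap)
  have "\<kappa> \<noteq> id" using assms(2) evenperm_id by auto
  then obtain x where x: "\<kappa> x \<noteq> x" by (auto simp: fun_eq_iff)
  let ?y = "\<kappa> x"
  show thesis
  proof (cases "\<kappa> ?y = x")
    case True
    obtain a b where d: "distinct [x, ?y, a, b]" using distinct_extend[of x ?y] x by metis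
    have "distinct [?y, x, \<kappa> a, \<kappa> b]" using distinct_values[OF assms(1) d] True by simp
    moreover have "\<kappa> a \<in> {x, ?y, a, b}" "\<kappa> b \<in> {x, ?y, a, b}" using UNIV_4_eq[OF d] by blast+
    ultimately have ab: "\<kappa> a = a \<and> \<kappa> b = b \<or> \<kappa> a = b \<and> \<kappa> b = a" by auto
    show thesis
    proof (cases "\<kappa> a = a")
      case True
      have "\<kappa> = Transposition.transpose x ?y"
        by (rule perms4_eqI[OF d]) (use True ab d \<open>\<kappa> ?y = x\<close> in auto)
      then show thesis using transposition[of x ?y] x by simp
    next
      case False
      have "\<kappa> = Transposition.transpose x ?y \<circ> Transposition.transpose a b"
        by (rule perms4_eqI[OF d]) (use False ab d \<open>\<kappa> ?y = x\<close> in auto)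
      then show thesis using even2[of x ?y a b] d assms(2) by auto
    qed
  next
    case False
    let ?z = "\<kappa> ?y"
    have yz: "?z \<noteq> ?y" using inj x by auto
    obtain w where d: "distinct [x, ?y, ?z, w]"
    proof -
      obtain a b where ab: "distinct [x, ?y, a, b]" using distinct_extend[of x ?y] x by metis
      moreover have "?z \<in> {x, ?y, a, b}" using UNIV_4_eq[OF ab] by blast
      ultimately have "?z = a \<or> ?z = b" using False yz by auto
      then show thesis using ab that[of a] that[of b] by auto
    qed
    have "distinct [?y, ?z, \<kappa> ?z, \<kappa> w]" using distinct_values[OF assms(1) d] by simp
    moreover have "\<kappa> ?z \<in> {x, ?y, ?z, w}" "\<kappa> w \<in> {x, ?y, ?z, w}" using UNIV_4_eq[OF d] by blast+
    ultimately have zw: "\<kappa> ?z = x \<and> \<kappa> w = w \<or> \<kappa> ?z = w \<and> \<kappa> w = x" by auto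
    show thesis
    proof (cases "\<kappa> ?z = x")
      case True
      have "\<kappa> = Transposition.transpose x ?y \<circ> Transposition.transpose ?y ?z"
        by (rule perms4_eqI[OF d]) (use True zw d in auto)
      then show thesis using even2[of x ?y ?y ?z] d assms(2) by auto
    next
      case False
      then show thesis using cycle[of x ?z w ?y] d zw by auto
    qed
  qed
qed

section \<open>Tracial positive functionals\<close>

lemma mult_left_eq: "p * q = s \<Longrightarrow> p * (q * w) = s * (w::'r::semigroup_mult)"
  by (simp flip: mult.assoc)

lemma mult_left_commute_eq:
  assumes "p * q = q * p" shows "p * (q * w) = q * (p * (w::'r::semigroup_mult))"
  unfolding mult.assoc[symmetric] by (rule arg_cong[OF assms])

lemma mult_left_eq3: "p * (q * q') = s \<Longrightarrow> p * (q * (q' * w)) = s * (w::'r::semigroup_mult)"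
  by (simp flip: mult.assoc)

lemma anticommute_square:
  "z * y = - (y * z) \<Longrightarrow> z * z * y = y * (z * (z::'r::ring))"
  by (metis minus_minus mult.assoc mult_minus_left mult_minus_right)

lemma mult_anticommute:
  fixes x :: "'r::ring"
  shows "z * x = - (x * z) \<Longrightarrow> z * y = y * z \<Longrightarrow> z * (x * y) = - (x * y * z)"
    and "z * x = x * z \<Longrightarrow> z * y = - (y * z) \<Longrightarrow> z * (x * y) = - (x * y * z)"
  unfolding mult.assoc[symmetric] by (simp_all only: mult.assoc mult_minus_left mult_minus_right)

lemma commute_mult_zero:
  fixes x :: "'r::ring"
  assumes "z * x = x * z" "z * y = y * z" "z * w = w * z" "w * z = 0"
  shows "z * (x * (y * w)) = 0"
proof -
  have "z * (x * (y * w)) = x * (z * (y * w))"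
    using mult_left_eq[OF assms(1)] by (simp add: mult.assoc)
  also have "z * (y * w) = y * (z * w)"
    using mult_left_eq[OF assms(2)] by (simp add: mult.assoc)
  finally show ?thesis using assms(3,4) by simp
qed

text \<open>
  In the application \<open>C\<close> is a commutant, \<open>S\<close> the set of its self-adjoint elements, and \<open>e\<close> the
  projection onto the cyclic subspace. The projection \<open>E\<close> in the last assumption is the spectral
  projection of \<open>a * a\<close> for the eigenvalue 1.
\<close>

locale magic_trace =
  fixes u :: "4 \<Rightarrow> 4 \<Rightarrow> 'r::real_algebra_1" and \<tau> :: "'r \<Rightarrow> real"
    and C :: "'r set" and S :: "'r set" and e :: 'r
  assumes magic: "magic u"
    and tau_linear: "linear \<tau>" and tau_one: "\<tau> 1 = 1"
    and C_add: "\<And>x y. x \<in> C \<Longrightarrow> y \<in> C \<Longrightarrow> x + y \<in> C"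
    and C_mult: "\<And>x y. x \<in> C \<Longrightarrow> y \<in> C \<Longrightarrow> x * y \<in> C"
    and S_C: "\<And>x. x \<in> S \<Longrightarrow> x \<in> C"
    and S_one: "1 \<in> S" and S_u: "\<And>i j. u i j \<in> S"
    and S_add: "\<And>x y. x \<in> S \<Longrightarrow> y \<in> S \<Longrightarrow> x + y \<in> S"
    and S_minus: "\<And>x. x \<in> S \<Longrightarrow> - x \<in> S"
    and S_mult: "\<And>x y. x \<in> S \<Longrightarrow> y \<in> S \<Longrightarrow> x * y = y * x \<Longrightarrow> x * y \<in> S"
    and tau_sandwich: "\<And>x y. x \<in> S \<Longrightarrow> y \<in> S \<Longrightarrow> 0 \<le> \<tau> (x * (y * y) * x)"
    and tau_reverse: "\<And>x y z. x \<in> S \<Longrightarrow> y \<in> S \<Longrightarrow> z \<in> S \<Longrightarrow> \<tau> (x * y * z) = \<tau> (z * y * x)"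
    and trace: "\<And>i j y. y \<in> C \<Longrightarrow> \<tau> (u i j * y) = \<tau> (y * u i j)"
    and support_ex: "\<And>a b d. a \<in> S \<Longrightarrow> b \<in> S \<Longrightarrow> d \<in> S \<Longrightarrow> a * a + b * b + d * d = 1 \<Longrightarrow>
       \<exists>E\<in>S. E * E = E \<and> a * a * E = E \<and> E * e = E \<and>
        (\<forall>b\<in>S. \<forall>d\<in>S. a * a + b * b + d * d = 1 \<longrightarrow> b * E = 0) \<and>
        (\<forall>y\<in>C. a * a * y = y * (a * a) \<longrightarrow> E * y = y * E) \<and>
        (\<forall>y\<in>C. a * a * y = y \<longrightarrow> y * e = y \<longrightarrow> E * y = y) \<and>
        (\<forall>y\<in>C. (\<forall>m. \<tau> ((a * a) ^ m * y) = \<tau> y) \<longrightarrow> \<tau> (E * y) = \<tau> y)"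
begin

section \<open>Positivity on the ranges of commuting projections\<close>

lemma S_diff: "x \<in> S \<Longrightarrow> y \<in> S \<Longrightarrow> x - y \<in> S"
  using S_add[of x "- y"] S_minus[of y] by simp

lemmas tau_add = linear_add[OF tau_linear] and tau_diff = linear_diff[OF tau_linear]
  and tau_minus = linear_neg[OF tau_linear] and tau_zero = linear_0[OF tau_linear]

lemma tau_square: "x \<in> S \<Longrightarrow> 0 \<le> \<tau> (x * x)"
  using tau_sandwich[OF S_one] by simp

lemma tau_double_nonneg: "0 \<le> \<tau> (y + y) \<Longrightarrow> 0 \<le> \<tau> y"
  by (simp add: tau_add)

lemma tau_proj_square:
  assumes "P \<in> S" "h \<in> S" "P * P = P" "P * h = h * P" shows "0 \<le> \<tau> (P * (h * h))"
proof -
  have "(h * P) * (h * P) = (P * h) * (P * h)" by (simp only: assms(4))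
  also have "\<dots> = P * (h * P) * h" by (simp only: mult.assoc)
  also have "\<dots> = P * (P * h) * h" by (simp only: assms(4))
  also have "\<dots> = P * P * (h * h)" by (simp only: mult.assoc)
  also have "\<dots> = P * (h * h)" by (simp only: assms(3))
  finally have "(h * P) * (h * P) = P * (h * h)" .
  then show ?thesis using tau_square[OF S_mult[OF assms(2,1) assms(4)[symmetric]]] by (simp only:)
qed

text \<open>On the range of \<open>P\<close> both \<open>x\<close> and \<open>y\<close> are
  commuting symmetries, so \<open>h = (1 + x) * (1 + y)\<close> satisfies
  \<open>P * (h * h) = 4 * P * h\<close>.\<close>

lemma tau_proj_shift_shift:
  assumes "P \<in> S" "x \<in> S" "y \<in> S" "P * P = P" "x * P = P * x" "y * P = P * y" "y * x = x * y"
    "P * (x * x) = P" "P * (y * y) = P"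
  shows "0 \<le> \<tau> P + \<tau> (P * x) + \<tau> (P * y) + \<tau> (P * (x * y))"
proof -
  let ?h = "1 + x + y + x * y" and ?z = "P + P * x + P * y + P * (x * y)"
  have r: "P * (x * (x * w)) = P * w" "P * (y * (y * w)) = P * w" "x * (P * w) = P * (x * w)"
      "y * (P * w) = P * (y * w)"
    "y * (x * w) = x * (y * w)" for w
    by (rule mult_left_eq3[OF assms(8)] mult_left_eq3[OF assms(9)] assms(5-7)[THEN
        mult_left_commute_eq])+
  have Pxyy: "P * (x * (y * y)) = P * x"
    using r(3)[of "y * y"] unfolding assms(9) assms(5) by (rule sym)
  have sq: "P * (?h * ?h) = (?z + ?z) + (?z + ?z)"
    by (simp add: distrib_left distrib_right mult.assoc assms(7-9) r Pxyy add_ac)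
  have comm: "P * ?h = ?h * P"
    by (simp add: distrib_left distrib_right mult.assoc assms(5,6) r)
  have S: "?h \<in> S"
    by (intro S_add S_one S_mult assms(2,3) assms(7)[symmetric])
  have "0 \<le> \<tau> ((?z + ?z) + (?z + ?z))"
    using tau_proj_square[OF assms(1) S assms(4) comm] unfolding sq .
  then have "0 \<le> \<tau> ?z" by (rule tau_double_nonneg[OF tau_double_nonneg])
  then show ?thesis by (simp add: tau_add)
qed

text \<open>Since \<open>x\<close> is a symmetry on the range of \<open>P\<close>, squaring
  \<open>(1 + x) * y\<close> gives \<open>2 * (1 + x) * (y * y)\<close> there.\<close>

lemma tau_proj_shift_square:
  assumes "P \<in> S" "x \<in> S" "y \<in> S" "P * P = P" "x * P = P * x" "y * P = P * y" "y * x = x * y"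
    "P * (x * x) = P"
  shows "0 \<le> \<tau> (P * (y * y)) + \<tau> (P * (x * (y * y)))"
proof -
  let ?h = "y + x * y" and ?z = "P * (y * y) + P * (x * (y * y))"
  have r: "P * (x * (x * w)) = P * w" "x * (P * w) = P * (x * w)" "y * (P * w) = P * (y * w)"
    "y * (x * w) = x * (y * w)" for w
    by (rule mult_left_eq3[OF assms(8)] assms(5-7)[THEN mult_left_commute_eq])+
  have sq: "P * (?h * ?h) = ?z + ?z"
    by (simp add: distrib_left distrib_right mult.assoc assms(7,8) r)
  have comm: "P * ?h = ?h * P"
    by (simp add: distrib_left distrib_right mult.assoc assms(5,6) r)
  have S: "?h \<in> S"
    by (intro S_add S_mult assms(2,3) assms(7)[symmetric])
  have "0 \<le> \<tau> (?z + ?z)"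
    using tau_proj_square[OF assms(1) S assms(4) comm] unfolding sq .
  then have "0 \<le> \<tau> ?z" by (rule tau_double_nonneg)
  then show ?thesis by (simp add: tau_add)
qed

text \<open>The functional is not assumed to be a trace on \<open>C\<close>. Only the entries of
  \<open>u\<close>, and elements inheriting the property by linearity, can be moved around
  cyclically.\<close>

definition tracial :: "'r \<Rightarrow> bool" where
  "tracial z \<longleftrightarrow> z \<in> S \<and> (\<forall>y\<in>C. \<tau> (z * y) = \<tau> (y * z))"

text \<open>Moving one factor \<open>z\<close> to the end and then past \<open>y\<close> changes the
  sign, while \<open>z * z\<close> commutes with \<open>y\<close>; hence the value equals its own
  negative.\<close>

lemma tau_anticommute:
  assumes "tracial z" "y \<in> C" "z * y = - (y * z)" shows "\<tau> (z * z * y) = 0"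
proof -
  have "\<tau> (z * (z * y)) = \<tau> ((z * y) * z)"
    using assms(1,2) C_mult[of z y] S_C[of z] unfolding tracial_def by blast
  also have "\<dots> = \<tau> (- (y * (z * z)))"
    by (simp add: assms(3) mult.assoc)
  also have "y * (z * z) = z * (z * y)"
    using anticommute_square[OF assms(3)] by (simp add: mult.assoc)
  also have "\<tau> (- \<dots>) = - \<tau> \<dots>" by (rule tau_minus)
  finally show ?thesis by (simp add: mult.assoc)
qed

definition supp :: "'r \<Rightarrow> 'r \<Rightarrow> bool" where
  "supp a E \<longleftrightarrow> E \<in> S \<and> E * E = E \<and> a * a * E = E \<and> E * e = E \<and>
        (\<forall>b\<in>S. \<forall>d\<in>S. a * a + b * b + d * d = 1 \<longrightarrow> b * E = 0) \<and>
        (\<forall>y\<in>C. a * a * y = y * (a * a) \<longrightarrow> E * y = y * E) \<and>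
        (\<forall>y\<in>C. a * a * y = y \<longrightarrow> y * e = y \<longrightarrow> E * y = y) \<and>
        (\<forall>y\<in>C. (\<forall>m. \<tau> ((a * a) ^ m * y) = \<tau> y) \<longrightarrow> \<tau> (E * y) = \<tau> y)"

lemma supp_kill:
  "supp a E \<Longrightarrow> b \<in> S \<Longrightarrow> d \<in> S \<Longrightarrow> a * a + b * b + d * d = 1 \<Longrightarrow> b * E = 0"
  unfolding supp_def by blast

text \<open>The squares of \<open>b\<close> and \<open>d\<close> contribute nothing by
  \<open>tau_anticommute\<close>, so multiplication by \<open>a * a\<close> preserves the value. As
  \<open>b\<close> and \<open>d\<close> commute with \<open>a * a\<close>, this can be iterated, and
  the last property of the support passes from the powers of \<open>a * a\<close> to
  \<open>E\<close>.\<close>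

lemma tau_supp:
  assumes E: "supp a E" and tr: "tracial a" "tracial b" "tracial d"
    and one: "a * a + b * b + d * d = 1"
    and ab: "b * a = - (a * b)" "d * a = - (a * d)"
    and y: "y \<in> C" "b * y = - (y * b)" "d * y = - (y * d)"
  shows "\<tau> (E * y) = \<tau> y"
proof -
  have step: "\<tau> (a * a * w) = \<tau> w" if "w \<in> C" "b * w = - (w * b)" "d * w = - (w * d)" for w
  proof -
    have "w = a * a * w + b * b * w + d * d * w"
      using arg_cong[OF one, of "\<lambda>z. z * w"] by (simp add: distrib_right)
    then have "\<tau> w = \<tau> (a * a * w) + \<tau> (b * b * w) + \<tau> (d * d * w)"
      by (metis tau_add)
    then show ?thesis using tau_anticommute[OF tr(2) that(1,2)] tau_anticommute[OF tr(3)
        that(1,3)] by simp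
  qed
  have aa: "b * (a * a) = a * a * b" "d * (a * a) = a * a * d"
    using ab by (metis minus_minus mult.assoc mult_minus_left mult_minus_right)+
  have "\<tau> ((a * a) ^ m * y) = \<tau> y \<and> (a * a) ^ m * y \<in> C \<and> b * ((a * a) ^ m * y) = - ((a * a) ^ m *
      y * b)
     \<and> d * ((a * a) ^ m * y) = - ((a * a) ^ m * y * d)" for m
  proof (induction m)
    case 0 then show ?case using y by simp
  next
    case (Suc m)
    let ?w = "(a * a) ^ m * y"
    have 1: "(a * a) ^ Suc m * y = a * a * ?w" by (simp add: mult.assoc)
    have "a * a \<in> C" using tr(1) unfolding tracial_def by (simp add: C_mult S_C)
    moreover have "b * (a * a * ?w) = - (a * a * ?w * b)" "d * (a * a * ?w) = - (a * a * ?w * d)"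
      using Suc aa by (metis mult.assoc mult_minus_right)+
    ultimately show ?case unfolding 1 using Suc step[of ?w] by (simp add: C_mult)
  qed
  then show ?thesis using E y(1) unfolding supp_def by blast
qed

section \<open>Support projections of the Fourier coefficients\<close>

lemma entry_S: "entry u r c i j \<in> S"
  unfolding entry_def by (intro S_diff S_add S_u S_one)

lemma entry_tracial: "tracial (entry u r c i j)"
  unfolding tracial_def entry_def using entry_S[of r c i j]
  by (auto simp: entry_def algebra_simps tau_add tau_diff trace)

lemma supp_E_ex:
  assumes "i \<noteq> r" "j \<noteq> c"
  shows "\<exists>E. supp (entry u r c i j) E"
proof -
  obtain l n where "distinct [c, j, l, n]" using assms(2) by (metis distinct_extend)
  from support_ex[OF entry_S entry_S entry_S entry_row_squares[OF magic this assms(1)]]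
  show ?thesis unfolding supp_def by blast
qed

definition E :: "4 \<Rightarrow> 4 \<Rightarrow> 4 \<Rightarrow> 4 \<Rightarrow> 'r" where
  "E r c i j = (SOME E. supp (entry u r c i j) E)"

lemma supp_E: "i \<noteq> r \<Longrightarrow> j \<noteq> c \<Longrightarrow> supp (entry u r c i j) (E r c i j)"
  unfolding E_def by (rule someI_ex) (rule supp_E_ex)

lemma E_S: "i \<noteq> r \<Longrightarrow> j \<noteq> c \<Longrightarrow> E r c i j \<in> S"
  and E_idem: "i \<noteq> r \<Longrightarrow> j \<noteq> c \<Longrightarrow> E r c i j * E r c i j = E r c i j"
  and entry_E: "i \<noteq> r \<Longrightarrow> j \<noteq> c \<Longrightarrow> entry u r c i j * entry u r c i j * E r c i j = E r c i j"
  and E_corner: "i \<noteq> r \<Longrightarrow> j \<noteq> c \<Longrightarrow> E r c i j * e = E r c i j"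
  using supp_E unfolding supp_def by auto

lemma E_commute:
  assumes "i \<noteq> r" "j \<noteq> c" "y \<in> C"
    "entry u r c i j * entry u r c i j * y = y * (entry u r c i j * entry u r c i j)"
  shows "E r c i j * y = y * E r c i j"
  using supp_E[OF assms(1,2)] assms(3,4) unfolding supp_def by blast

lemma E_absorb:
  assumes "i \<noteq> r" "j \<noteq> c" "y \<in> C" "entry u r c i j * entry u r c i j * y = y" "y * e = y"
  shows "E r c i j * y = y"
  using supp_E[OF assms(1,2)] assms(3-5) unfolding supp_def by blast

text \<open>The squares in a row sum to 1, so where one of them equals 1 the other two entries
  vanish.\<close>

lemma entry_row_E:
  assumes "distinct [c, j, l, n]" "i \<noteq> r" shows "entry u r c i l * E r c i j = 0"
  by (rule supp_kill[OF supp_E entry_S entry_S entry_row_squares[OF magic assms]]) (use assms in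
      auto)

lemma entry_col_E:
  assumes "distinct [r, i, k, m]" "j \<noteq> c" shows "entry u r c k j * E r c i j = 0"
  by (rule supp_kill[OF supp_E entry_S entry_S entry_col_squares[OF magic assms]]) (use assms in
      auto)

lemma square_commute:
  assumes "distinct [r, i, k, m]" "distinct [c, j, l, n]"
  shows "entry u r c i j * entry u r c i j * entry u r c i j = entry u r c i j * (entry u r c i j
      * entry u r c i j)"
   and "entry u r c i j * entry u r c i j * entry u r c i l = entry u r c i l * (entry u r c i j *
       entry u r c i j)"
   and "entry u r c i j * entry u r c i j * entry u r c k j = entry u r c k j * (entry u r c i j *
       entry u r c i j)"
   and "entry u r c i j * entry u r c i j * entry u r c k l = entry u r c k l * (entry u r c i j *
       entry u r c i j)"
proof -
  let ?a = "entry u r c i j"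
  have d: "distinct [r, k, i, m]" "distinct [c, l, j, n]" using assms by auto
  show "?a * ?a * ?a = ?a * (?a * ?a)" by (rule mult.assoc)
  show "?a * ?a * entry u r c i l = entry u r c i l * (?a * ?a)"
    using entry_row_anticommute[OF magic d(2), of i r] assms(1) by (intro anticommute_square) auto
  show "?a * ?a * entry u r c k j = entry u r c k j * (?a * ?a)"
    using entry_col_anticommute[OF magic d(1), of j c] assms(2) by (intro anticommute_square) auto
  show "?a * ?a * entry u r c k l = entry u r c k l * (?a * ?a)"
    using entry_commute[OF magic assms] by (metis mult.assoc)
qed

lemma E_entry_commute:
  assumes "distinct [r, i, k, m]" "distinct [c, j, l, n]" "i' \<noteq> r" "j' \<noteq> c"
  shows "E r c i j * entry u r c i' j' = entry u r c i' j' * E r c i j"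
proof (rule E_commute)
  show "i \<noteq> r" "j \<noteq> c" "entry u r c i' j' \<in> C" using assms entry_S S_C by auto
  have "i' \<in> {i, k, m}" "j' \<in> {j, l, n}"
    using assms UNIV_4_eq[OF assms(1)] UNIV_4_eq[OF assms(2)] by auto
  moreover have d: "distinct [r, i, m, k]" "distinct [c, j, n, l]" using assms by auto
  ultimately show "entry u r c i j * entry u r c i j * entry u r c i' j' = entry u r c i' j' *
      (entry u r c i j * entry u r c i j)"
    using square_commute[OF assms(1,2)] square_commute[OF d(1) assms(2)]
      square_commute[OF assms(1) d(2)] square_commute[OF d] by auto
qed

text \<open>The product anticommutes with the other two entries of row \<open>m\<close>, so
  \<open>E r c m n\<close> may be inserted by \<open>tau_supp\<close>. Then \<open>a k l\<close> is
  expanded as the minor \<open>a i j * a m n + a m j * a i n\<close>, whose second term is killed by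
  the projection.\<close>

lemma tau_entry_mult:
  assumes "distinct [r, i, k, m]" "distinct [c, j, l, n]"
  shows "\<tau> (entry u r c i j * entry u r c k l) = \<tau> (E r c m n * (entry u r c i j * (entry u r c i
      j * entry u r c m n)))"
proof -
  let ?a = "entry u r c"
  have d: "distinct [r, m, i, k]" "distinct [c, n, j, l]" "distinct [r, k, m, i]"
      "distinct [r, i, m, k]"
    "distinct [c, j, n, l]" "distinct [r, m, k, i]" "distinct [c, n, l, j]"
        "distinct [c, l, n, j]" "distinct [c, l, j, n]" "distinct [r, k, i, m]"
        "distinct [r, i, m, k]"
    using assms by auto
  have n: "m \<noteq> r" "n \<noteq> c" "i \<noteq> r" "j \<noteq> c" "k \<noteq> r" "l \<noteq> c" using assms by auto
  have 1: "?a m j * (?a i j * ?a k l) = - (?a i j * ?a k l * ?a m j)"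
    by (rule mult_anticommute(1)[OF entry_col_anticommute[OF magic d(4) n(4)] entry_commute[OF
        magic d(3) d(9)]])
  have 2: "?a m l * (?a i j * ?a k l) = - (?a i j * ?a k l * ?a m l)"
    by (rule mult_anticommute(2)[OF entry_commute[OF magic d(4) assms(2)] entry_col_anticommute[OF
        magic d(3) n(6)]])
  have "\<tau> (?a i j * ?a k l) = \<tau> (E r c m n * (?a i j * ?a k l))"
  proof (rule tau_supp[symmetric])
    show "supp (?a m n) (E r c m n)" by (rule supp_E) (use n in auto)
    show "?a m n * ?a m n + ?a m j * ?a m j + ?a m l * ?a m l = 1"
      by (rule entry_row_squares[OF magic d(2) n(1)])
    show "?a m j * ?a m n = - (?a m n * ?a m j)"
      by (rule entry_row_anticommute[OF magic d(2) n(1)])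
    show "?a m l * ?a m n = - (?a m n * ?a m l)"
      by (rule entry_row_anticommute[OF magic d(7) n(1)])
  qed (use 1 2 entry_tracial entry_S S_C C_mult in auto)
  have kl: "?a k l = ?a i j * ?a m n + ?a m j * ?a i n"
    by (rule entry_minor[OF magic d(4) d(5), symmetric])
  have "?a i n * E r c m n = 0"
    by (rule entry_col_E[OF d(1) n(2)])
  moreover have "E r c m n * ?a i n = ?a i n * E r c m n" "E r c m n * ?a m j = ?a m j * E r c m n"
     "E r c m n * ?a i j = ?a i j * E r c m n"
    by (rule E_entry_commute[OF d(1) d(2)], (use n in auto))+
  ultimately have "E r c m n * (?a i j * (?a m j * ?a i n)) = 0"
    by (intro commute_mult_zero)
  then show ?thesis
    unfolding \<open>\<tau> (?a i j * ?a k l) = _\<close> by (subst kl) (simp add: distrib_left)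
qed

text \<open>
  With \<open>x1 = a i j\<close>, \<open>x2 = a k l\<close>, \<open>x3 = a m n\<close>, \<open>y2 = a k n\<close>, \<open>y3 = a m l\<close> and the central
  projections \<open>E1, E2, E3, G2, G3\<close> belonging to them, the value is that of
  \<open>x1 * x1 * (1 + E3 * x3 + E2 * x2 + G2 * y2 - G3 * y3) + E1 * x1 * (x2 * x2 - y2 * y2)\<close>. On the
  range of \<open>1 - E1\<close> the other four projections are orthogonal and each \<open>x\<close> is a symmetry on the
  range of its projection; on the range of \<open>E1\<close> one has \<open>x3 = x1 * x2\<close> and \<open>y3 = x1 * y2\<close>, so that
  the projections coincide in pairs.
\<close>

lemma tau_bilinear_nonneg:
  fixes r i k m c j l n :: 4
  assumes "distinct [r, i, k, m]" "distinct [c, j, l, n]"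
  defines "a \<equiv> entry u r c"
  shows "0 \<le> \<tau> (a i j * a i j) + \<tau> (a k l * a m n) - \<tau> (a k n * a m l)
    + \<tau> (a i j * a k l) + \<tau> (a i j * a m n) + \<tau> (a i j * a m l) - \<tau> (a i j * a k n)"
proof -
  define x1 x2 x3 y2 y3 where "x1 = a i j" and "x2 = a k l" and "x3 = a m n"
    and "y2 = a k n" and "y3 = a m l"
  note x_def = x1_def x2_def x3_def y2_def y3_def a_def
  define E1 E2 E3 G2 G3 where "E1 = E r c i j" and "E2 = E r c k l" and "E3 = E r c m n"
    and "G2 = E r c k n" and "G3 = E r c m l"
  note E_defs = E1_def E2_def E3_def G2_def G3_def
  have n: "i \<noteq> r" "k \<noteq> r" "m \<noteq> r" "j \<noteq> c" "l \<noteq> c" "n \<noteq> c"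
    using assms by auto
  have d: "distinct [r, i, m, k]" "distinct [r, k, i, m]" "distinct [r, k, m, i]"
      "distinct [r, m, i, k]" "distinct [r, m, k, i]"
    "distinct [c, j, n, l]" "distinct [c, l, j, n]" "distinct [c, l, n, j]"
        "distinct [c, n, j, l]" "distinct [c, n, l, j]"
    using assms by auto
  note r1 = assms(1) d(1) and r2 = d(2,3) and r3 = d(4,5)
  note c1' = assms(2) d(6) and c2' = d(7,8) and c3' = d(9,10)
  have E_entry: "E r c k' l' * entry u r c i' j' = entry u r c i' j' * E r c k' l'"
    if n': "i' \<noteq> r" "j' \<noteq> c" "k' \<noteq> r" "l' \<noteq> c" for i' j' k' l'
  proof -
    obtain a b where "distinct [r, k', a, b]" using n'(3) by (metis distinct_extend)
    moreover obtain a' b' where "distinct [c, l', a', b']" using n'(4) by (metis distinct_extend)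
    ultimately show ?thesis using n' by (intro E_entry_commute)
  qed
  have EE: "E r c i' j' * E r c k' l' = E r c k' l' * E r c i' j'"
    if n': "i' \<noteq> r" "j' \<noteq> c" "k' \<noteq> r" "l' \<noteq> c" for i' j' k' l'
  proof (rule E_commute)
    have "E r c k' l' * entry u r c i' j' = entry u r c i' j' * E r c k' l'"
      using n' by (rule E_entry)
    then show "entry u r c i' j' * entry u r c i' j' * E r c k' l' = E r c k' l' * (entry u r c i'
        j' * entry u r c i' j')"
      by (metis mult.assoc)
  qed (use n' E_S S_C in auto)
  have E_comm: "E2 * E1 = E1 * E2" "E3 * E1 = E1 * E3" "E3 * E2 = E2 * E3" "G2 * E1 = E1 * G2"
     "G3 * E1 = E1 * G3" "G3 * G2 = G2 * G3"
    unfolding E_defs by (intro EE n)+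
  have S: "x1 \<in> S" "x2 \<in> S" "x3 \<in> S" "y2 \<in> S" "y3 \<in> S" "E1 \<in> S" "E2 \<in> S" "E3 \<in> S" "G2 \<in> S" "G3 \<in> S"
    unfolding x_def E_defs by (intro entry_S E_S n)+
  have idem: "E1 * E1 = E1" "E2 * E2 = E2" "E3 * E3 = E3" "G2 * G2 = G2" "G3 * G3 = G3"
    unfolding E_defs by (intro E_idem n)+
  have "\<forall>x\<in>{x1, x2, x3, y2, y3}. \<forall>z\<in>{E1, E2, E3, G2, G3}. x * z = z * x"
    unfolding x_def E_defs ball_simps by (intro conjI TrueI E_entry[symmetric] n)
  then have xE: "x * z = z * x" if "x \<in> {x1, x2, x3, y2, y3}" "z \<in> {E1, E2, E3, G2, G3}" for x z
    using that by blast
  have xx: "x2 * x1 = x1 * x2" "x3 * x1 = x1 * x3" "y2 * x1 = x1 * y2" "y3 * x1 = x1 * y3"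
    unfolding x_def by (rule entry_commute[OF magic r1(1) c1'(1)] entry_commute[OF magic r1(2)
        c1'(2)]
      entry_commute[OF magic r1(1) c1'(2)] entry_commute[OF magic r1(2) c1'(1)])+
  have sq: "x1 * x1 * E1 = E1" "x2 * x2 * E2 = E2" "x3 * x3 * E3 = E3" "y2 * y2 * G2 = G2"
      "y3 * y3 * G3 = G3"
    unfolding x_def E_defs by (intro entry_E n)+
  have kill: "x3 * G2 = 0" "x3 * G3 = 0" "y2 * E2 = 0" "y3 * E2 = 0" "y2 * E3 = 0" "y3 * E3 = 0"
      "x2 * G2 = 0" "x2 * G3 = 0"
      "a k j * E1 = 0" "a i l * E1 = 0" "a i n * E1 = 0" "a i l * E2 = 0" "a i l * G3 = 0"
      "a i n * E3 = 0" "a i n * G2 = 0"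
    unfolding x_def E_defs
    by (rule entry_col_E[OF r1(1) n(4)] entry_row_E[OF c1'(1) n(1)] entry_row_E[OF c1'(2) n(1)]
        entry_col_E[OF r2(1) n(5)] entry_col_E[OF r2(2) n(5)] entry_row_E[OF c2'(2) n(2)]
        entry_col_E[OF r3(1) n(6)] entry_col_E[OF r3(2) n(6)] entry_row_E[OF c3'(2) n(3)]
        entry_col_E[OF r2(1) n(6)] entry_col_E[OF r2(2) n(6)] entry_row_E[OF c3'(2) n(2)]
        entry_col_E[OF r3(1) n(5)] entry_col_E[OF r3(2) n(5)] entry_row_E[OF c2'(2) n(3)])+
  \<comment> \<open>On the range of \<open>G\<close> the factor \<open>z * z\<close> acts as 1, and
    one of its two factors \<open>z\<close> annihilates \<open>E\<close>.\<close>
  have orth: "E * G = 0" if "z * E = 0" "z * E = E * z" "z * z * G = G" for z E G :: 'r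
  proof -
    have "E * G = E * z * (z * G)" using that(3) by (metis mult.assoc)
    then show ?thesis using that(1,2) by simp
  qed
  have EG: "E2 * G2 = 0" "E2 * G3 = 0" "E3 * G2 = 0" "E3 * G3 = 0"
     "G2 * E2 = 0" "G3 * E2 = 0" "G2 * E3 = 0" "G3 * E3 = 0"
    using orth[OF kill(3) xE sq(4)] orth[OF kill(4) xE sq(5)] orth[OF kill(5) xE sq(4)] orth[OF
        kill(6) xE sq(5)]
      orth[OF kill(7) xE sq(2)] orth[OF kill(8) xE sq(2)] orth[OF kill(1) xE sq(3)] orth[OF
          kill(2) xE sq(3)]
    by simp_all
  have x1_unit: "x1 * x1 * z = z" if "a i l * z = 0" "a i n * z = 0" for z
    using arg_cong[OF entry_row_squares[OF magic c1'(1) n(1)], of "\<lambda>w. w * z"] that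
    unfolding x_def by (simp add: distrib_right mult.assoc)
  have corner: "E1 * e = E1" "E2 * e = E2" "E3 * e = E3" "G2 * e = G2" "G3 * e = G3"
    unfolding E_defs by (intro E_corner n)+
  have c1: "x1 * E1 = E1 * x1" "x2 * E1 = E1 * x2" "x3 * E1 = E1 * x3" "y2 * E1 = E1 * y2"
      "y3 * E1 = E1 * y3"
    and c2: "x1 * E2 = E2 * x1" "x2 * E2 = E2 * x2" "x1 * E3 = E3 * x1" "x3 * E3 = E3 * x3"
    "x1 * G2 = G2 * x1" "y2 * G2 = G2 * y2" "x1 * G3 = G3 * x1" "y3 * G3 = G3 * y3"
    "x3 * E2 = E2 * x3" "y3 * G2 = G2 * y3"
    by ((rule xE; simp)+)[15]
  note lc1 = c1[THEN mult_left_commute_eq] and lc2 = c2[THEN mult_left_commute_eq]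
    and lEc = E_comm[THEN mult_left_commute_eq] and lxx = xx[THEN mult_left_commute_eq]
    and lidem = idem[THEN mult_left_eq]
  \<comment> \<open>\<open>E2\<close> kills \<open>a i l\<close> and \<open>E3\<close> kills
    \<open>a i n\<close>, the two other entries of row \<open>i\<close>. So \<open>x1 * x1\<close>
    is 1 on the common range, which therefore lies in the range of \<open>E1\<close>.\<close>
  have "x1 * x1 * (E2 * E3) = E2 * E3"
  proof (rule x1_unit)
    show "a i l * (E2 * E3) = 0" by (simp add: mult_left_eq[OF kill(12)])
    show "a i n * (E2 * E3) = 0" unfolding E_comm(3)[symmetric]
        by (simp add: mult_left_eq[OF kill(14)])
  qed
  then have E23: "E1 * (E2 * E3) = E2 * E3"
    unfolding x1_def a_def E1_def
    by (rule E_absorb[rotated 3]) (use n S S_C C_mult corner in \<open>auto simp: mult.assoc\<close>)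
  have "x1 * x1 * (G2 * G3) = G2 * G3"
  proof (rule x1_unit)
    show "a i n * (G2 * G3) = 0" by (simp add: mult_left_eq[OF kill(15)])
    show "a i l * (G2 * G3) = 0" unfolding E_comm(6)[symmetric]
        by (simp add: mult_left_eq[OF kill(13)])
  qed
  then have G23: "E1 * (G2 * G3) = G2 * G3"
    unfolding x1_def a_def E1_def
    by (rule E_absorb[rotated 3]) (use n S S_C C_mult corner in \<open>auto simp: mult.assoc\<close>)
  \<comment> \<open>In the minor relation \<open>x3 = x1 * x2 + a k j * a i l\<close> the second
    product vanishes on the range of \<open>E1\<close>.\<close>
  have E1x3: "E1 * x3 = E1 * (x1 * x2)"
  proof -
    have "x3 * E1 = x1 * (x2 * E1) + a k j * (a i l * E1)"
      using entry_minor[OF magic r1(1) c1'(1)] unfolding x_def by (metis distrib_right mult.assoc)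
    then show ?thesis using kill(10) by (simp only: mult_zero_right add_0_right c1 lc1)
  qed
  have E1y3: "E1 * y3 = E1 * (x1 * y2)"
  proof -
    have "y3 * E1 = x1 * (y2 * E1) + a k j * (a i n * E1)"
      using entry_minor[OF magic r1(1) c1'(2)] unfolding x_def by (metis distrib_right mult.assoc)
    then show ?thesis using kill(11) by (simp only: mult_zero_right add_0_right c1 lc1)
  qed
  have x2y2: "E1 * (x2 * x2) + E1 * (y2 * y2) = E1"
  proof -
    have "(a k j * a k j + x2 * x2 + y2 * y2) * E1 = E1"
      using entry_row_squares[OF magic c1'(1) n(2)] unfolding x_def by simp
    then show ?thesis using kill(9) by (simp only: distrib_right mult.assoc mult_zero_right
        add_0_left c1 lc1)
  qed
  have E1x1: "E1 * (x1 * x1) = E1" and E2x2: "E2 * (x2 * x2) = E2" and E3x3: "E3 * (x3 * x3) = E3"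
    and G2y2: "G2 * (y2 * y2) = G2" and G3y3: "G3 * (y3 * y3) = G3"
    using sq by (simp_all only: mult.assoc c1 c2 lc1 lc2)
  have x3x3E1: "E1 * (x3 * x3) = E1 * (x2 * x2)"
  proof -
    have "E1 * (x3 * x3) = x1 * (x2 * (E1 * x3))" by (simp only: mult_left_eq[OF E1x3] mult.assoc
        lc1)
    also have "\<dots> = E1 * (x1 * (x1 * (x2 * x2)))" by (simp only: E1x3 lc1 lxx)
    finally show ?thesis by (simp only: mult_left_eq3[OF E1x1])
  qed
  have y3y3E1: "E1 * (y3 * y3) = E1 * (y2 * y2)"
  proof -
    have "E1 * (y3 * y3) = x1 * (y2 * (E1 * y3))" by (simp only: mult_left_eq[OF E1y3] mult.assoc
        lc1)
    also have "\<dots> = E1 * (x1 * (x1 * (y2 * y2)))" by (simp only: E1y3 lc1 lxx)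
    finally show ?thesis by (simp only: mult_left_eq3[OF E1x1])
  qed
  \<comment> \<open>On the range of \<open>E1\<close> the squares of \<open>x2\<close> and
    \<open>x3\<close> agree, so \<open>E2\<close> and \<open>E3\<close> absorb each other there, and
    likewise \<open>G2\<close> and \<open>G3\<close>. With \<open>E23\<close> and
    \<open>G23\<close>, all pairwise products within \<open>E1, E2, E3\<close> coincide, and so do
    those within \<open>E1, G2, G3\<close>.\<close>
  have "x3 * x3 * (E1 * E2) = E1 * E2" "y3 * y3 * (E1 * G2) = E1 * G2"
    using sq(2,4) mult_left_eq3[OF x3x3E1] mult_left_eq3[OF y3y3E1]
        by (simp_all only: mult.assoc lc1)
  moreover have "x2 * x2 * (E1 * E3) = E1 * E3" "y2 * y2 * (E1 * G3) = E1 * G3"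
    using sq(3,5) mult_left_eq3[OF x3x3E1[symmetric]] mult_left_eq3[OF y3y3E1[symmetric]]
    by (simp_all only: mult.assoc lc1)
  ultimately have "E3 * (E1 * E2) = E1 * E2" "E2 * (E1 * E3) = E1 * E3" "G3 * (E1 * G2) = E1 * G2"
      "G2 * (E1 * G3) = E1 * G3"
    unfolding x_def E2_def E3_def G2_def G3_def
    by ((intro E_absorb n; use n S E_S S_C C_mult corner E_corner in \<open>auto simp: E1_def
        mult.assoc\<close>)+)
  then have P2: "E1 * E3 = E1 * E2" "E2 * E3 = E1 * E2" and Q2: "E1 * G3 = E1 * G2"
      "G2 * G3 = E1 * G2"
    using E23 G23 by (simp_all only: lEc E_comm)
  note es = idem lidem E_comm lEc EG EG[THEN mult_left_eq] P2 Q2 P2[THEN mult_left_eq] Q2[THEN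
      mult_left_eq]
    mult.assoc mult_zero_left mult_zero_right
  have PS: "E1 * E2 \<in> S" "E1 * G2 \<in> S" using S E_comm by (auto intro: S_mult)
  have Px1: "E1 * (E2 * (x1 * (x1 * w))) = E1 * (E2 * w)"
      "E1 * (G2 * (x1 * (x1 * w))) = E1 * (G2 * w)" for w
    using arg_cong[OF mult_left_eq3[OF E1x1, of w], of "(*) E2"]
      arg_cong[OF mult_left_eq3[OF E1x1, of w], of "(*) G2"] by (simp_all only: lEc)
  have Px1': "E1 * (E2 * (x1 * x1)) = E1 * E2" "E1 * (G2 * (x1 * x1)) = E1 * G2"
    using Px1[of 1] by simp_all
  have Px2: "E1 * (E2 * (x2 * x2)) = E1 * E2" "E1 * (G2 * (y2 * y2)) = E1 * G2"
    by (simp_all only: E2x2 G2y2)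
  have Px3: "E1 * (E2 * (x3 * x3)) = E1 * E2" "E1 * (G2 * (y3 * y3)) = E1 * G2"
    using arg_cong[OF x3x3E1, of "(*) E2"] arg_cong[OF y3y3E1, of "(*) G2"]
        by (simp_all only: lEc Px2)
  have Px3': "E1 * (E2 * x3) = E1 * (E2 * (x1 * x2))" "E1 * (G2 * y3) = E1 * (G2 * (x1 * y2))"
    using arg_cong[OF E1x3, of "(*) E2"] arg_cong[OF E1y3, of "(*) G2"] by (simp_all only: lEc)
  have E2x1: "E1 * (E2 * (x1 * (x2 * x2))) = E1 * (E2 * x1)" and G2x1:
      "E1 * (G2 * (x1 * (y2 * y2))) = E1 * (G2 * x1)"
    using arg_cong[OF E2x2, of "\<lambda>z. x1 * (E1 * z)"] arg_cong[OF G2y2, of "\<lambda>z. x1 * (E1 * z)"]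
    by (simp_all only: lc1 lc2 c1 c2)
  note ps = Px1 Px1' Px2 Px3 E1x1 E2x2 E3x3 G2y2 G3y3 c1 c2 lc1 lc2 xx lxx es
  note ds = left_diff_distrib right_diff_distrib distrib_left distrib_right
  \<comment> \<open>The projection onto the complement of all five ranges, by inclusion-exclusion:
    three equal pairwise products minus the equal triple product leave \<open>E1 * E2\<close> twice,
    and similarly \<open>E1 * G2\<close> twice.\<close>
  define D where "D = 1 - E1 - E2 - E3 - G2 - G3 + (E1 * E2 + E1 * E2) + (E1 * G2 + E1 * G2)"
  have "0 \<le> \<tau> (D * (x1 * x1))"
  proof (rule tau_proj_square)
    show "D \<in> S" unfolding D_def by (intro S_add S_diff S_one PS S)
    show "D * D = D" unfolding D_def by (simp add: ds es)
    show "D * x1 = x1 * D" unfolding D_def by (simp add: ds ps)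
  qed (rule S)
  then have D: "0 \<le> \<tau> (x1 * x1) - \<tau> E1 - \<tau> (E2 * (x1 * x1)) - \<tau> (E3 * (x1 * x1)) - \<tau> (G2 * (x1 *
      x1))
     - \<tau> (G3 * (x1 * x1)) + 2 * \<tau> (E1 * E2) + 2 * \<tau> (E1 * G2)"
    unfolding D_def by (simp add: ds ps tau_add tau_diff)
  \<comment> \<open>The subtracted product restricts to the part outside \<open>E1\<close>, where
    \<open>x2\<close> is a symmetry. The next three inequalities do the same with \<open>x3\<close>,
    \<open>y2\<close> and \<open>- y3\<close>; the last sign is that of
    \<open>\<tau> (a i j * a k n)\<close> in the claim.\<close>
  have "0 \<le> \<tau> ((E2 - E1 * E2) * (x1 * x1)) + \<tau> ((E2 - E1 * E2) * (x2 * (x1 * x1)))"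
    by (rule tau_proj_shift_square) (simp_all add: S S_diff PS ds ps)
  then have C2: "0 \<le> \<tau> (E2 * (x1 * x1)) - \<tau> (E1 * E2) + \<tau> (E2 * (x1 * (x1 * x2))) - \<tau> (E1 * (E2 *
      x2))"
    by (simp add: ds ps tau_diff)
  have "0 \<le> \<tau> ((E3 - E1 * E2) * (x1 * x1)) + \<tau> ((E3 - E1 * E2) * (x3 * (x1 * x1)))"
    by (rule tau_proj_shift_square) (simp_all add: S S_diff PS ds ps)
  then have C3: "0 \<le> \<tau> (E3 * (x1 * x1)) - \<tau> (E1 * E2) + \<tau> (E3 * (x1 * (x1 * x3))) - \<tau> (E1 * (E2 *
      (x1 * x2)))"
    by (simp add: ds ps tau_diff Px3')
  have "0 \<le> \<tau> ((G2 - E1 * G2) * (x1 * x1)) + \<tau> ((G2 - E1 * G2) * (y2 * (x1 * x1)))"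
    by (rule tau_proj_shift_square) (simp_all add: S S_diff PS ds ps)
  then have C4: "0 \<le> \<tau> (G2 * (x1 * x1)) - \<tau> (E1 * G2) + \<tau> (G2 * (x1 * (x1 * y2))) - \<tau> (E1 * (G2 *
      y2))"
    by (simp add: ds ps tau_diff)
  have "0 \<le> \<tau> ((G3 - E1 * G2) * (x1 * x1)) + \<tau> ((G3 - E1 * G2) * (- y3 * (x1 * x1)))"
    by (rule tau_proj_shift_square) (simp_all add: S S_diff S_minus PS ds ps)
  then have C5: "0 \<le> \<tau> (G3 * (x1 * x1)) - \<tau> (E1 * G2) - \<tau> (G3 * (x1 * (x1 * y3))) + \<tau> (E1 * (G2 *
      (x1 * y2)))"
    by (simp add: ds ps tau_diff tau_minus Px3')
  \<comment> \<open>On the range of \<open>E1 * E2\<close> both \<open>x1\<close> and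
    \<open>x2\<close> are symmetries, on that of \<open>E1 * G2\<close> both \<open>- x1\<close> and
    \<open>y2\<close>. These inequalities compensate the terms with \<open>E1 * E2\<close> and
    \<open>E1 * G2\<close> subtracted in the others.\<close>
  have "0 \<le> \<tau> (E1 * E2) + \<tau> (E1 * E2 * x1) + \<tau> (E1 * E2 * x2) + \<tau> (E1 * E2 * (x1 * x2))"
    by (rule tau_proj_shift_shift) (simp_all add: S PS ps)
  then have A1: "0 \<le> \<tau> (E1 * E2) + \<tau> (E1 * (E2 * x1)) + \<tau> (E1 * (E2 * x2)) + \<tau> (E1 * (E2 * (x1 *
      x2)))"
    by (simp add: mult.assoc)
  have "0 \<le> \<tau> (E1 * G2) + \<tau> (E1 * G2 * - x1) + \<tau> (E1 * G2 * y2) + \<tau> (E1 * G2 * (- x1 * y2))"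
    by (rule tau_proj_shift_shift) (simp_all add: S S_minus PS ps)
  then have A2: "0 \<le> \<tau> (E1 * G2) - \<tau> (E1 * (G2 * x1)) + \<tau> (E1 * (G2 * y2)) - \<tau> (E1 * (G2 * (x1 *
      y2)))"
    by (simp add: mult.assoc tau_minus)
  \<comment> \<open>On the rest of \<open>E1\<close> only \<open>x1\<close> is known to be a
    symmetry, giving the factor \<open>1 + x1\<close> for \<open>x2 * x2\<close> and, below,
    \<open>1 - x1\<close> for \<open>y2 * y2\<close>.\<close>
  have "0 \<le> \<tau> ((E1 - E1 * E2) * (x2 * x2)) + \<tau> ((E1 - E1 * E2) * (x1 * (x2 * x2)))"
    by (rule tau_proj_shift_square) (simp_all add: S S_diff PS ds ps)
  then have B1: "0 \<le> \<tau> (E1 * (x2 * x2)) - \<tau> (E1 * E2) + \<tau> (E1 * (x1 * (x2 * x2))) - \<tau> (E1 * (E2 *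
      x1))"
    by (simp add: ds ps tau_diff E2x1)
  have "0 \<le> \<tau> ((E1 - E1 * G2) * (y2 * y2)) + \<tau> ((E1 - E1 * G2) * (- x1 * (y2 * y2)))"
    by (rule tau_proj_shift_square) (simp_all add: S S_diff S_minus PS ds ps)
  then have B2: "0 \<le> \<tau> (E1 * (y2 * y2)) - \<tau> (E1 * G2) - \<tau> (E1 * (x1 * (y2 * y2))) + \<tau> (E1 * (G2 *
      x1))"
    by (simp add: ds ps tau_diff tau_minus G2x1)
  \<comment> \<open>Each product of two entries receives the support of the entry in the third row
    and third column.\<close>
  have T: "\<tau> (x2 * x3) = \<tau> (E1 * (x1 * (x2 * x2)))" "\<tau> (y2 * y3) = \<tau> (E1 * (x1 * (y2 * y2)))"
    "\<tau> (x1 * x2) = \<tau> (E3 * (x1 * (x1 * x3)))" "\<tau> (x1 * x3) = \<tau> (E2 * (x1 * (x1 * x2)))"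
    "\<tau> (x1 * y3) = \<tau> (G2 * (x1 * (x1 * y2)))" "\<tau> (x1 * y2) = \<tau> (G3 * (x1 * (x1 * y3)))"
    using tau_entry_mult[OF r2(2) c2'(2)] tau_entry_mult[OF r2(2) c3'(2)] tau_entry_mult[OF r1(1)
        c1'(1)]
      tau_entry_mult[OF r1(2) c1'(2)] tau_entry_mult[OF r1(2) c1'(1)] tau_entry_mult[OF r1(1)
          c1'(2)]
    by (simp_all only: x_def[symmetric] E_defs[symmetric] xx lxx)
  \<comment> \<open>With this identity the claim is the plain sum of the nine inequalities
    \<open>D\<close>, \<open>C2\<close> to \<open>C5\<close>, \<open>A1\<close>, \<open>A2\<close>,
    \<open>B1\<close>, \<open>B2\<close>.\<close>
  have "\<tau> (E1 * (x2 * x2)) + \<tau> (E1 * (y2 * y2)) = \<tau> E1"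
    using x2y2 by (metis tau_add)
  then have "0 \<le> \<tau> (x1 * x1) + \<tau> (x2 * x3) - \<tau> (y2 * y3) + \<tau> (x1 * x2) + \<tau> (x1 * x3) + \<tau> (x1 * y3)
      - \<tau> (x1 * y2)"
    unfolding T using D C2 C3 C4 C5 A1 A2 B1 B2 by linarith
  then show ?thesis unfolding x1_def x2_def x3_def y2_def y3_def .
qed

section \<open>Signed weights on the permutations\<close>

lemma u_row: "l \<noteq> k \<Longrightarrow> u i l * u i k = 0" and u_col: "i \<noteq> j \<Longrightarrow> u i l * u j l = 0"
  and u_idem: "u i l * u i l = u i l"
  and u_sum_row: "(\<Sum>l\<in>UNIV. u i l) = 1" and u_sum_col: "(\<Sum>i\<in>UNIV. u i l) = 1"
  using magic by (auto simp: magic_def)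

lemma u_C: "u i l \<in> C"
  by (rule S_C[OF S_u])

lemma tau_cycle: "\<tau> (u i l * u j k * u m n) = \<tau> (u j k * u m n * u i l)"
  using trace[OF C_mult[OF u_C u_C]] by (simp add: mult.assoc)

text \<open>Reversal followed by a cyclic shift. Together with \<open>tau_cycle\<close> it makes the
  value independent of the order of the three factors.\<close>

lemma tau_swap: "\<tau> (u i l * u j k * u m n) = \<tau> (u j k * u i l * u m n)"
  using tau_reverse[OF S_u S_u S_u, of i l j k m n] tau_cycle[of m n j k i l] by simp

lemma tau_expand_row:
  assumes "distinct [\<alpha>, \<beta>, \<gamma>, \<delta>]"
  shows "\<tau> (u i \<alpha> * u j \<beta> * u a \<gamma>) + \<tau> (u i \<alpha> * u j \<beta> * u a \<delta>) + \<tau> (u i \<alpha> * u j \<beta> * u a \<alpha>)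
      + \<tau> (u i \<alpha> * u j \<beta> * u a \<beta>) = \<tau> (u i \<alpha> * u j \<beta>)"
proof -
  have "distinct [\<gamma>, \<delta>, \<alpha>, \<beta>]" using assms by auto
  from sum_UNIV_4[OF this, of "u a"] have "u a \<gamma> + u a \<delta> + u a \<alpha> + u a \<beta> = 1"
      by (simp add: u_sum_row)
  then show ?thesis by (metis tau_add distrib_left mult.right_neutral)
qed

lemma tau_expand:
  assumes "distinct [\<alpha>, \<beta>, \<gamma>, \<delta>]" "i \<noteq> a" "j \<noteq> a"
  shows "\<tau> (u i \<alpha> * u j \<beta> * u a \<gamma>) + \<tau> (u i \<alpha> * u j \<beta> * u a \<delta>) = \<tau> (u i \<alpha> * u j \<beta>)"
proof -
  have "\<tau> (u i \<alpha> * u j \<beta> * u a \<alpha>) = 0" "\<tau> (u i \<alpha> * u j \<beta> * u a \<beta>) = 0"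
    unfolding tau_cycle[of i \<alpha>] using u_col assms(2,3) tau_cycle[of j \<beta> a \<alpha> i \<alpha>]
    by (simp_all add: mult.assoc tau_zero)
  then show ?thesis using tau_expand_row[OF assms(1), of i j a] by simp
qed

text \<open>Row \<open>o'\<close> is the one that does not occur in the triple products. Its entry
  in column \<open>\<delta>\<close> is eliminated by the column sum, and the remaining products of
  two entries are expanded along the rows \<open>i\<close> and \<open>j\<close>.\<close>

lemma tau_opposite:
  assumes "distinct [o', i, j, k]" "distinct [\<alpha>, \<beta>, \<gamma>, \<delta>]"
  shows "\<tau> (u i \<alpha> * u j \<beta> * u k \<gamma>) + \<tau> (u i \<beta> * u j \<alpha> * u k \<gamma>) = \<tau> (u k \<gamma> * u o' \<delta>)"
proof -
  have d: "distinct [\<gamma>, \<alpha>, \<beta>, \<delta>]" "distinct [\<gamma>, \<alpha>, \<delta>, \<beta>]" "distinct [\<gamma>, \<beta>, \<alpha>, \<delta>]"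
      "distinct [\<gamma>, \<delta>, \<alpha>, \<beta>]" using assms by auto
  have n: "k \<noteq> i" "k \<noteq> j" "i \<noteq> j" "\<gamma> \<noteq> \<delta>" using assms by auto
  have "u k \<gamma> * u o' \<delta> + u k \<gamma> * u i \<delta> + u k \<gamma> * u j \<delta> + u k \<gamma> * u k \<delta> = u k \<gamma>"
    using sum_UNIV_4[OF assms(1), of "\<lambda>i. u i \<delta>"] unfolding u_sum_col
    by (metis distrib_left mult.right_neutral)
  then have 1: "\<tau> (u k \<gamma> * u o' \<delta>) + \<tau> (u k \<gamma> * u i \<delta>) + \<tau> (u k \<gamma> * u j \<delta>) = \<tau> (u k \<gamma>)"
    unfolding u_row[OF n(4)] by (metis tau_add add.right_neutral)
  have "u k \<gamma> * u i \<gamma> + u k \<gamma> * u i \<alpha> + u k \<gamma> * u i \<beta> + u k \<gamma> * u i \<delta> = u k \<gamma>"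
    using sum_UNIV_4[OF d(1), of "u i"] unfolding u_sum_row
    by (metis distrib_left mult.right_neutral)
  then have 2: "\<tau> (u k \<gamma> * u i \<alpha>) + \<tau> (u k \<gamma> * u i \<beta>) + \<tau> (u k \<gamma> * u i \<delta>) = \<tau> (u k \<gamma>)"
    unfolding u_col[OF n(1)] by (metis tau_add add_0)
  have 3: "\<tau> (u k \<gamma> * u i \<alpha>) = \<tau> (u i \<alpha> * u j \<beta> * u k \<gamma>) + \<tau> (u k \<gamma> * u i \<alpha> * u j \<delta>)"
    using tau_expand[OF d(1), of k j i] n tau_cycle[of k \<gamma> i \<alpha> j \<beta>] by simp
  have 4: "\<tau> (u k \<gamma> * u i \<beta>) = \<tau> (u i \<beta> * u j \<alpha> * u k \<gamma>) + \<tau> (u k \<gamma> * u i \<beta> * u j \<delta>)"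
    using tau_expand[OF d(3), of k j i] n tau_cycle[of k \<gamma> i \<beta> j \<alpha>] by simp
  have 5: "\<tau> (u k \<gamma> * u j \<delta>) = \<tau> (u k \<gamma> * u i \<alpha> * u j \<delta>) + \<tau> (u k \<gamma> * u i \<beta> * u j \<delta>)"
    using tau_expand[OF d(4), of k i j] n tau_cycle tau_swap by metis
  show ?thesis using 1 2 3 4 5 by linarith
qed

text \<open>
  Another choice of three rows changes the weights only by a multiple of the sign character.
\<close>

definition perm_weight :: "(4 \<Rightarrow> 4) \<Rightarrow> real" where
  "perm_weight \<pi> = \<tau> (u 1 (\<pi> 1) * u 2 (\<pi> 2) * u 3 (\<pi> 3))"

lemma perm_weight_eq:
  assumes "distinct [0, i, j, k]" shows "perm_weight \<pi> = \<tau> (u i (\<pi> i) * u j (\<pi> j) * u k (\<pi> k))"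
proof -
  have "UNIV = {0, 1, 2, 3 :: 4}" by (rule UNIV_4_eq) simp
  then have "i \<in> {0,1,2,3}" "j \<in> {0,1,2,3}" "k \<in> {0,1,2,3}" by blast+
  then have "(i, j, k) \<in> {(1,2,3), (1,3,2), (2,1,3), (2,3,1), (3,1,2), (3,2,1)}"
    using assms by auto
  moreover have "\<tau> (u i l * u k n * u j m) = \<tau> (u i l * u j m * u k n)" for i j k l m n
    using tau_swap tau_cycle by metis
  ultimately show ?thesis unfolding perm_weight_def using tau_swap by auto
qed

text \<open>If the transposition moves row 0, the row missing from the weight, the two terms are an
  expansion along one row; if it fixes row 0, the relation is \<open>tau_opposite\<close>.\<close>

lemma perm_weight_edge:
  assumes "\<pi> \<in> perms4" "distinct [i, j, a, b]"
  shows "perm_weight \<pi> + perm_weight (\<pi> \<circ> Transposition.transpose a b) = \<tau> (u i (\<pi> i) * u j (\<pi> j))"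
proof -
  have \<pi>: "distinct [\<pi> i, \<pi> j, \<pi> a, \<pi> b]" by (rule distinct_values[OF assms])
  have d: "distinct [\<pi> i, \<pi> j, \<pi> b, \<pi> a]" "distinct [\<pi> a, \<pi> b, \<pi> i, \<pi> j]"
      "distinct [\<pi> a, \<pi> b, \<pi> j, \<pi> i]"
    using \<pi> by auto
  have "0 \<in> {i, j, a, b}" using UNIV_4_eq[OF assms(2)] by blast
  then consider "b = 0" | "a = 0" | "i = 0" | "j = 0" by auto
  then show ?thesis
  proof cases
    case 1
    then have "distinct [0, i, j, a]" using assms(2) by auto
    then show ?thesis using tau_expand[OF \<pi>, of i a j] assms(2) by (simp add: perm_weight_eq)
  next
    case 2
    then have "distinct [0, i, j, b]" using assms(2) by auto
    then show ?thesis using tau_expand[OF d(1), of i b j] assms(2) by (simp add: perm_weight_eq)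
  next
    case 3
    then have "distinct [0, a, b, j]" using assms(2) by auto
    then show ?thesis using tau_opposite[OF _ d(3), of 0 a b j] assms(2) 3 trace[OF u_C]
      by (simp add: perm_weight_eq)
  next
    case 4
    then have "distinct [0, a, b, i]" using assms(2) by auto
    then show ?thesis using tau_opposite[OF _ d(2), of 0 a b i] assms(2) 4
      by (simp add: perm_weight_eq)
  qed
qed

lemma tau_sum: "\<tau> (sum f A) = (\<Sum>x\<in>A. \<tau> (f x))"
  by (rule linear_sum[OF tau_linear])

text \<open>A signed decomposition into permutations; the individual weights may still be
  negative.\<close>

lemma tau_u_mult: "\<tau> (u i l * u j k) = (\<Sum>\<pi>\<in>perms4. perm_weight \<pi> * of_bool (\<pi> i = l \<and> \<pi> j = k))"
proof (rule two_values_sum[where q = "\<lambda>i l j k. \<tau> (u i l * u j k)"])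
  fix i l j show "(\<Sum>k\<in>UNIV. \<tau> (u i l * u j k)) = \<tau> (u i l * u i l)"
    by (simp add: u_sum_row u_idem flip: tau_sum sum_distrib_left)
qed (simp_all add: perm_weight_edge u_row u_col tau_zero)

lemma tau_u: "\<tau> (u i l) = (\<Sum>\<pi>\<in>perms4. perm_weight \<pi> * of_bool (\<pi> i = l))"
  using tau_u_mult[of i l i l] by (simp add: u_idem)

lemma sum_perm_weight: "(\<Sum>\<pi>\<in>perms4. perm_weight \<pi>) = 1"
proof -
  have "1 = \<tau> (\<Sum>l\<in>UNIV. u 0 l)" by (simp add: u_sum_row tau_one)
  also have "\<dots> = (\<Sum>\<pi>\<in>perms4. \<Sum>l\<in>UNIV. perm_weight \<pi> * of_bool (\<pi> 0 = l))"
    unfolding tau_sum tau_u by (rule sum.swap)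
  also have "\<dots> = (\<Sum>\<pi>\<in>perms4. perm_weight \<pi>)"
    by (rule sum.cong[OF refl]) (simp add: of_bool_def if_distrib cong: if_cong)
  finally show ?thesis by simp
qed

text \<open>Traces of expressions of degree at most two in \<open>u\<close> are weighted sums of
  their values at permutation matrices; \<open>\<epsilon>\<close> is the value of
  \<open>entry\<close> at the matrix of \<open>\<pi>\<close>.\<close>

lemma tau_entry_entry:
  defines "\<epsilon> \<equiv> \<lambda>\<pi> r c i j. of_bool (\<pi> r = c) + of_bool (\<pi> r = j) + of_bool (\<pi> i = c) + of_bool (\<pi>
      i = j) - (1::real)"
  shows "\<tau> (entry u r c i j * entry u r c k l) = (\<Sum>\<pi>\<in>perms4. perm_weight \<pi> * (\<epsilon> \<pi> r c i j * \<epsilon> \<pi> r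
      c k l))"
proof -
  have "\<tau> 1 = (\<Sum>\<pi>\<in>perms4. perm_weight \<pi>)" by (simp add: tau_one sum_perm_weight)
  then show ?thesis
    unfolding entry_def \<epsilon>_def
    by (simp only: distrib_left distrib_right left_diff_distrib right_diff_distrib mult_1_left
        mult_1_right
       tau_add tau_diff tau_u_mult tau_u sum.distrib sum_subtractf of_bool_conj)
qed

text \<open>
  The bilinear expression of \<open>tau_bilinear_nonneg\<close>, evaluated at permutation matrices, is 4 at \<open>\<sigma>\<close>
  and at \<open>\<rho>\<close> and vanishes at the other 22 permutations.
\<close>

lemma perm_weight_cycle_nonneg:
  assumes \<sigma>: "\<sigma> \<in> perms4" and \<rho>: "\<rho> \<in> perms4" and d: "distinct [r, i, k, m]"
    and "\<rho> r = \<sigma> m" "\<rho> m = \<sigma> i" "\<rho> i = \<sigma> k" "\<rho> k = \<sigma> r"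
  shows "0 \<le> perm_weight \<sigma> + perm_weight \<rho>"
proof -
  define c j l n where "c = \<sigma> r" and "j = \<sigma> i" and "l = \<sigma> k" and "n = \<sigma> m"
  note cdefs = c_def j_def l_def n_def
  have dc: "distinct [c, j, l, n]" unfolding cdefs by (rule distinct_values[OF \<sigma> d])
  define f :: "(4 \<Rightarrow> 4) \<Rightarrow> 4 \<Rightarrow> 4 \<Rightarrow> real" where
    "f \<pi> i j = of_bool (\<pi> r = c) + of_bool (\<pi> r = j) + of_bool (\<pi> i = c) + of_bool (\<pi> i = j) - 1"
        for \<pi> i j
  define g where "g \<pi> = f \<pi> i j * f \<pi> i j + f \<pi> k l * f \<pi> m n - f \<pi> k n * f \<pi> m l
    + f \<pi> i j * f \<pi> k l + f \<pi> i j * f \<pi> m n + f \<pi> i j * f \<pi> m l - f \<pi> i j * f \<pi> k n" for \<pi>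
  have g: "g \<pi> = 4 * of_bool (\<pi> = \<sigma>) + 4 * of_bool (\<pi> = \<rho>)" if "\<pi> \<in> perms4" for \<pi>
  proof -
    have "\<pi> = \<sigma> \<longleftrightarrow> \<pi> r = c \<and> \<pi> i = j \<and> \<pi> k = l \<and> \<pi> m = n"
      "\<pi> = \<rho> \<longleftrightarrow> \<pi> r = n \<and> \<pi> i = l \<and> \<pi> k = c \<and> \<pi> m = j"
      using perms4_eqI[OF d, of \<pi> \<sigma>] perms4_eqI[OF d, of \<pi> \<rho>] assms(4-7) unfolding cdefs by auto
    note eqs = this
    have dpi: "\<pi> r \<noteq> \<pi> i" "\<pi> r \<noteq> \<pi> k" "\<pi> r \<noteq> \<pi> m" "\<pi> i \<noteq> \<pi> k" "\<pi> i \<noteq> \<pi> m" "\<pi> k \<noteq> \<pi> m"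
      using distinct_values[OF that d] by auto
    have ne: "c \<noteq> j" "c \<noteq> l" "c \<noteq> n" "j \<noteq> l" "j \<noteq> n" "l \<noteq> n"
      "j \<noteq> c" "l \<noteq> c" "n \<noteq> c" "l \<noteq> j" "n \<noteq> j" "n \<noteq> l"
      using dc by auto
    have val: "x = c \<or> x = j \<or> x = l \<or> x = n" for x using UNIV_4_eq[OF dc] by blast
    \<comment> \<open>Twelve choices for the images of \<open>r\<close> and \<open>i\<close>, each
      with two completions, enumerate all 24 permutations.\<close>
    have "(\<pi> r, \<pi> i) \<in> {(c, j), (c, l), (c, n), (j, c), (j, l), (j, n), (l, c), (l, j), (l, n),
        (n, c), (n, j), (n, l)}"
      using val[of "\<pi> r"] val[of "\<pi> i"] dpi(1) by auto
    then show ?thesis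
      using dpi(2-) val[of "\<pi> k"] val[of "\<pi> m"]
      by (elim insertE emptyE disjE Pair_inject) (simp_all add: g_def f_def eqs ne)
  qed
  have "0 \<le> (\<Sum>\<pi>\<in>perms4. perm_weight \<pi> * g \<pi>)"
    using tau_bilinear_nonneg[OF d dc]
    unfolding tau_entry_entry f_def[symmetric] g_def
    by (simp only: distrib_left right_diff_distrib sum.distrib sum_subtractf)
  also have "\<dots> = (\<Sum>\<pi>\<in>perms4. 4 * (perm_weight \<pi> * of_bool (\<pi> = \<sigma>)) + 4 * (perm_weight \<pi> * of_bool
      (\<pi> = \<rho>)))"
    by (rule sum.cong) (simp_all add: g algebra_simps)
  also have "\<dots> = 4 * perm_weight \<sigma> + 4 * perm_weight \<rho>"
  proof -
    have "(\<Sum>\<pi>\<in>perms4. perm_weight \<pi> * of_bool (\<pi> = \<kappa>)) = perm_weight \<kappa>" if "\<kappa> \<in> perms4" for \<kappa>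
      using that finite_perms4 by (simp add: of_bool_def if_distrib cong: if_cong)
    then show ?thesis using \<sigma> \<rho> by (simp only: sum.distrib flip: sum_distrib_left)
  qed
  finally show ?thesis by simp
qed

text \<open>The quotient of \<open>\<rho>\<close> by \<open>\<sigma>\<close> is odd, hence a
  transposition, where the sum is a value of the correlation, or a 4-cycle, where
  \<open>perm_weight_cycle_nonneg\<close> applies.\<close>

lemma perm_weight_opposite_parity:
  assumes \<sigma>: "\<sigma> \<in> perms4" "evenperm \<sigma>" and \<rho>: "\<rho> \<in> perms4" "\<not> evenperm \<rho>"
  shows "0 \<le> perm_weight \<sigma> + perm_weight \<rho>"
proof -
  define \<kappa> where "\<kappa> = inv \<sigma> \<circ> \<rho>"
  have perm: "permutation \<sigma>" "permutation \<rho>"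
    using \<sigma>(1) \<rho>(1) by (auto intro: perms4_permutation)
  have \<kappa>: "\<kappa> \<in> perms4" "\<not> evenperm \<kappa>"
    using assms perm unfolding \<kappa>_def
    by (simp_all add: permutes_compose permutes_inv evenperm_comp evenperm_inv permutation_inverse)
  have \<rho>_eq: "\<rho> x = \<sigma> (\<kappa> x)" for x
    using \<sigma>(1) unfolding \<kappa>_def by (simp add: permutes_inverses)
  from \<kappa> show ?thesis
  proof (cases rule: odd_perms4_cases)
    case (transposition a b)
    obtain i j where "distinct [a, b, i, j]" using transposition(1) by (metis distinct_extend)
    then have d: "distinct [i, j, a, b]" by auto
    have "\<rho> = \<sigma> \<circ> Transposition.transpose a b" using \<rho>_eq transposition(2) by auto
    then have "perm_weight \<sigma> + perm_weight \<rho> = \<tau> (u i (\<sigma> i) * u j (\<sigma> j))"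
        using perm_weight_edge[OF \<sigma>(1) d] by simp
    \<comment> \<open>Idempotence doubles one entry and the trace property moves a copy to the
      front, which produces a product covered by \<open>tau_sandwich\<close>.\<close>
    also have "\<dots> = \<tau> (u j (\<sigma> j) * u i (\<sigma> i) * u j (\<sigma> j))"
      using trace[OF C_mult[OF u_C u_C], of j "\<sigma> j" i "\<sigma> i" j "\<sigma> j"]
          by (simp add: mult.assoc u_idem)
    also have "0 \<le> \<dots>" using tau_sandwich[OF S_u S_u, of j "\<sigma> j" i "\<sigma> i"] by (simp add: u_idem)
    finally show ?thesis .
  next
    case (cycle r i k m)
    then show ?thesis using perm_weight_cycle_nonneg[OF \<sigma>(1) \<rho>(1) cycle(1)] \<rho>_eq by metis
  qed
qed

text \<open>Subtracting the least even weight \<open>t\<close> from the even weights and adding it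
  to the odd ones makes all of them nonnegative, the odd ones by comparison with the even
  permutation \<open>\<sigma>0\<close> attaining \<open>t\<close>. A transposition changes the
  parity, so the shift cancels in every edge relation.\<close>

lemma classical:
  assumes "\<And>l k i j. p $ (l, k, i, j) = \<tau> (u i l * u j k)"
  shows "p \<in> classical_correlations"
proof -
  let ?even = "{\<sigma> \<in> perms4. evenperm \<sigma>}"
  define t where "t = Min (perm_weight ` ?even)"
  define w where "w \<pi> = (if evenperm \<pi> then perm_weight \<pi> - t else perm_weight \<pi> + t)" for \<pi>
  have fin: "finite (perm_weight ` ?even)" using finite_perms4 by simp
  have "id \<in> ?even" by (simp add: permutes_id)
  then have "t \<in> perm_weight ` ?even" unfolding t_def using fin by (intro Min_in) blast+
  then obtain \<sigma>0 where \<sigma>0: "\<sigma>0 \<in> perms4" "evenperm \<sigma>0" "t = perm_weight \<sigma>0" by auto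
  have w_nonneg: "0 \<le> w \<pi>" if "\<pi> \<in> perms4" for \<pi>
    using that perm_weight_opposite_parity[OF \<sigma>0(1,2), of \<pi>] Min_le[OF fin, of
        "perm_weight \<pi>"] \<sigma>0(3)
    unfolding w_def t_def[symmetric] by auto
  have tau_w: "\<tau> (u i l * u j k) = (\<Sum>\<pi>\<in>perms4. w \<pi> * of_bool (\<pi> i = l \<and> \<pi> j = k))" for i l j k
  proof (rule two_values_sum[where q = "\<lambda>i l j k. \<tau> (u i l * u j k)"])
    fix \<pi> i j a b assume *: "\<pi> \<in> perms4" "distinct [i, j, a, b :: 4]"
    then have "evenperm (\<pi> \<circ> Transposition.transpose a b) \<longleftrightarrow> \<not> evenperm \<pi>"
      by (auto simp: evenperm_comp evenperm_swap permutation_swap_id perms4_permutation)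
    then show "w \<pi> + w (\<pi> \<circ> Transposition.transpose a b) = \<tau> (u i (\<pi> i) * u j (\<pi> j))"
      using perm_weight_edge[OF *] unfolding w_def by auto
  next
    fix i l j show "(\<Sum>k\<in>UNIV. \<tau> (u i l * u j k)) = \<tau> (u i l * u i l)"
      by (simp add: u_sum_row u_idem flip: tau_sum sum_distrib_left)
  qed (simp_all add: u_row u_col tau_zero)
  have "1 = \<tau> (\<Sum>l\<in>UNIV. u 0 l * u 0 l)" by (simp add: u_sum_row u_idem tau_one)
  also have "\<dots> = (\<Sum>\<pi>\<in>perms4. \<Sum>l\<in>UNIV. w \<pi> * of_bool (\<pi> 0 = l \<and> \<pi> 0 = l))"
    unfolding tau_sum tau_w by (rule sum.swap)
  also have "\<dots> = (\<Sum>\<pi>\<in>perms4. w \<pi>)"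
    by (rule sum.cong[OF refl]) (simp add: of_bool_def if_distrib cong: if_cong)
  finally have sum_w: "(\<Sum>\<pi>\<in>perms4. w \<pi>) = 1" ..
  have "p = (\<Sum>\<pi>\<in>perms4. w \<pi> *\<^sub>R perm_corr \<pi>)"
  proof (rule vec_eq_iff[THEN iffD2], rule allI)
    fix x :: "4 \<times> 4 \<times> 4 \<times> 4"
    obtain l k i j where x: "x = (l, k, i, j)" by (cases x)
    have "(\<Sum>\<pi>\<in>perms4. w \<pi> *\<^sub>R perm_corr \<pi>) $ x = (\<Sum>\<pi>\<in>perms4. w \<pi> * of_bool (\<pi> i = l \<and> \<pi> j = k))"
      unfolding sum_component by (rule sum.cong) (auto simp: x perm_corr_def)
    then show "p $ x = (\<Sum>\<pi>\<in>perms4. w \<pi> *\<^sub>R perm_corr \<pi>) $ x"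
      unfolding x assms tau_w by simp
  qed
  also have "\<dots> \<in> classical_correlations"
    unfolding classical_correlations_def
    by (rule convex_sum[OF finite_perms4 convex_convex_hull sum_w w_nonneg]) (auto intro: hull_inc)
  finally show ?thesis .
qed

end

section \<open>Linear endomorphisms as an algebra\<close>

text \<open>
  The additional real coordinate guarantees \<open>0 \<noteq> 1\<close> even over the trivial vector space.
\<close>

typedef (overloaded) 'a endo = "{f :: 'a::real_vector \<times> real \<Rightarrow> 'a \<times> real. linear f}"
  morphisms app Endo
  by (rule exI[of _ "\<lambda>_. 0"]) (simp add: linear_zero)

setup_lifting type_definition_endo

lemma linear_app: "linear (app x)"
  using app[of x] by simp

instantiation endo :: (real_vector) real_algebra_1
begin

lift_definition zero_endo :: "'a endo" is "\<lambda>_. 0" by (simp add: linear_zero)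
lift_definition one_endo :: "'a endo" is "\<lambda>v. v" by (simp add: linear_ident)
lift_definition plus_endo :: "'a endo \<Rightarrow> 'a endo \<Rightarrow> 'a endo" is "\<lambda>f g v. f v + g v"
  by (simp add: linear_compose_add)
lift_definition minus_endo :: "'a endo \<Rightarrow> 'a endo \<Rightarrow> 'a endo" is "\<lambda>f g v. f v - g v"
  by (simp add: linear_compose_sub)
lift_definition uminus_endo :: "'a endo \<Rightarrow> 'a endo" is "\<lambda>f v. - f v"
  by (simp add: linear_compose_neg)
lift_definition times_endo :: "'a endo \<Rightarrow> 'a endo \<Rightarrow> 'a endo" is "\<lambda>f g v. f (g v)"
  using linear_compose by (auto simp: o_def)
lift_definition scaleR_endo :: "real \<Rightarrow> 'a endo \<Rightarrow> 'a endo" is "\<lambda>r f v. r *\<^sub>R f v"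
  by (simp add: linear_compose_scale_right)

instance
proof
  fix x y z :: "'a endo" and r s :: real
  show "x + y + z = x + (y + z)" by transfer (simp add: add.assoc)
  show "x + y = y + x" by transfer (simp add: add.commute)
  show "0 + x = x" by transfer simp
  show "- x + x = 0" by transfer simp
  show "x - y = x + - y" by transfer simp
  show "x * y * z = x * (y * z)" by transfer simp
  show "1 * x = x" by transfer simp
  show "x * 1 = x" by transfer simp
  show "(x + y) * z = x * z + y * z" by transfer simp
  show "x * (y + z) = x * y + x * z" by transfer (simp add: linear_add)
  show "(0 :: 'a endo) \<noteq> 1"
  proof transfer
    show "(\<lambda>_. 0) \<noteq> (\<lambda>v :: 'a \<times> real. v)"
      by (rule notI, drule fun_cong[of _ _ "(0, 1)"]) (simp add: zero_prod_def)
  qed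
  show "r *\<^sub>R (x + y) = r *\<^sub>R x + r *\<^sub>R y" by transfer (simp add: scaleR_add_right)
  show "(r + s) *\<^sub>R x = r *\<^sub>R x + s *\<^sub>R x" by transfer (simp add: scaleR_add_left)
  show "r *\<^sub>R s *\<^sub>R x = (r * s) *\<^sub>R x" by transfer simp
  show "1 *\<^sub>R x = x" by transfer simp
  show "r *\<^sub>R x * y = r *\<^sub>R (x * y)" by transfer simp
  show "x * r *\<^sub>R y = r *\<^sub>R (x * y)" by transfer (simp add: linear_scale)
qed

end

section \<open>Commuting operators on a Hilbert space\<close>

text \<open>By symmetry the inner product of the powers \<open>2 * m\<close> and
  \<open>2 * n\<close> is \<open>q (m + n)\<close>, where \<open>q\<close> decreases to a limit.
  Hence the squared distance \<open>q (m + m) - 2 * q (m + n) + q (n + n)\<close> tends to 0. Even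
  exponents also avoid the alternation caused by an eigenvalue -1.\<close>

lemma symmetric_contraction_powers_convergent:
  fixes A :: "'h::{real_inner,complete_space} \<Rightarrow> 'h"
  assumes A_K: "\<And>v. v \<in> K \<Longrightarrow> A v \<in> K"
    and sym: "\<And>v w. v \<in> K \<Longrightarrow> w \<in> K \<Longrightarrow> inner (A v) w = inner v (A w)"
    and contr: "\<And>v. v \<in> K \<Longrightarrow> norm (A v) \<le> norm v"
    and v: "v \<in> K"
  shows "convergent (\<lambda>m. (A ^^ (2 * m)) v)"
proof -
  have pow_K: "(A ^^ k) w \<in> K" if "w \<in> K" for k w by (induction k) (use that A_K in auto)
  have pow_sym: "inner ((A ^^ k) w) w' = inner w ((A ^^ k) w')" if "w \<in> K" "w' \<in> K" for k w w'
    using that by (induction k arbitrary: w w') (simp_all add: sym pow_K A_K funpow_swap1)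
  define q where "q k = (norm ((A ^^ k) v))\<^sup>2" for k
  have inner_q: "inner ((A ^^ (2 * m)) v) ((A ^^ (2 * n)) v) = q (m + n)" if "m \<le> n" for m n
  proof -
    have "(A ^^ (n - m + (m + n))) v = (A ^^ (n - m)) ((A ^^ (m + n)) v)"
      "(A ^^ (n - m + 2 * m)) v = (A ^^ (n - m)) ((A ^^ (2 * m)) v)"
      by (simp_all only: funpow_add o_apply)
    moreover have "n - m + (m + n) = 2 * n" "n - m + 2 * m = m + n" using that by simp_all
    ultimately show ?thesis
      using pow_sym[OF pow_K[OF v] pow_K[OF v], of "n - m" "2 * m" "m + n"]
      unfolding q_def power2_norm_eq_inner by metis
  qed
  have "decseq q"
    unfolding decseq_Suc_iff q_def
  proof
    fix k
    show "(norm ((A ^^ Suc k) v))\<^sup>2 \<le> (norm ((A ^^ k) v))\<^sup>2"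
      using contr[OF pow_K[OF v]] by (intro power_mono) simp_all
  qed
  then obtain L where L: "q \<longlonglongrightarrow> L"
    by (rule decseq_convergent[of q 0]) (simp add: q_def)
  have "Cauchy (\<lambda>m. (A ^^ (2 * m)) v)"
  proof (rule metric_CauchyI)
    fix \<epsilon> :: real assume "\<epsilon> > 0"
    \<comment> \<open>The three values of \<open>q\<close> enter with total absolute coefficient 1 +
      2 + 1 = 4.\<close>
    then have "0 < \<epsilon>\<^sup>2 / 4" by simp
    from LIMSEQ_D[OF L this] obtain k0 where k0: "\<And>k. k \<ge> k0 \<Longrightarrow> \<bar>q k - L\<bar> < \<epsilon>\<^sup>2 / 4"
      unfolding real_norm_def by blast
    have *: "dist ((A ^^ (2 * m)) v) ((A ^^ (2 * n)) v) < \<epsilon>" if "m \<ge> k0" "m \<le> n" for m n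
    proof -
      have "(norm ((A ^^ (2 * m)) v - (A ^^ (2 * n)) v))\<^sup>2 = q (m + m) - 2 * q (m + n) + q (n + n)"
        using inner_q[OF that(2)] inner_q[of m m] inner_q[of n n]
        by (simp add: power2_norm_eq_inner inner_diff_left inner_diff_right inner_commute)
      also have "\<dots> < \<epsilon>\<^sup>2"
        using k0[of "m + m"] k0[of "m + n"] k0[of "n + n"] that by linarith
      finally show ?thesis using \<open>\<epsilon> > 0\<close> by (simp add: dist_norm power_less_imp_less_base)
    qed
    have "dist ((A ^^ (2 * m)) v) ((A ^^ (2 * n)) v) < \<epsilon>" if "m \<ge> k0" "n \<ge> k0" for m n
      using *[of m n] *[of n m] that by (cases "m \<le> n") (simp_all add: dist_commute)
    then show "\<exists>k0. \<forall>m\<ge>k0. \<forall>n\<ge>k0. dist ((A ^^ (2 * m)) v) ((A ^^ (2 * n)) v) < \<epsilon>" by blast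
  qed
  then show ?thesis by (simp add: Cauchy_convergent_iff)
qed

text \<open>The relations of a magic unitary are only assumed on \<open>K\<close>. The map
  \<open>R\<close> is a linear, possibly discontinuous, projection onto \<open>K\<close>, used to
  extend operators on \<open>K\<close> to the whole type.\<close>

locale hilbert_model =
  fixes K :: "'h::{real_inner,complete_space} set" and R :: "'h \<Rightarrow> 'h" and \<psi> :: 'h
    and M N :: "4 \<Rightarrow> 4 \<Rightarrow> 'h \<Rightarrow> 'h"
  assumes K_subspace: "subspace K" and K_closed: "closed K" and psi_K: "\<psi> \<in> K" and norm_psi:
      "norm \<psi> = 1"
    and R_linear: "linear R" and R_K: "\<And>v. R v \<in> K" and R_id: "\<And>v. v \<in> K \<Longrightarrow> R v = v"
    and M_bounded: "\<And>i l. bounded_linear (M i l)" and N_bounded: "\<And>i l. bounded_linear (N i l)"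
    and M_K: "\<And>i l v. v \<in> K \<Longrightarrow> M i l v \<in> K" and N_K: "\<And>i l v. v \<in> K \<Longrightarrow> N i l v \<in> K"
    and M_sym: "\<And>i l v w. inner (M i l v) w = inner v (M i l w)"
    and N_sym: "\<And>i l v w. inner (N i l v) w = inner v (N i l w)"
    and MN: "\<And>i l j k v. M i l (N j k v) = N j k (M i l v)"
    and M_psi: "\<And>i l. M i l \<psi> = N i l \<psi>"
    and M_idem: "\<And>i l v. v \<in> K \<Longrightarrow> M i l (M i l v) = M i l v"
    and M_orth: "\<And>i l j k v. v \<in> K \<Longrightarrow> (i = j) \<noteq> (l = k) \<Longrightarrow> M i l (M j k v) = 0"
    and M_row: "\<And>i v. v \<in> K \<Longrightarrow> (\<Sum>l\<in>UNIV. M i l v) = v"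
    and M_col: "\<And>l v. v \<in> K \<Longrightarrow> (\<Sum>i\<in>UNIV. M i l v) = v"
begin

text \<open>Only the values of \<open>f\<close> on \<open>K\<close> matter, and \<open>f\<close> has
  to be linear there for the argument of \<open>Endo\<close> to lie in its domain.\<close>

definition corner_op :: "('h \<Rightarrow> 'h) \<Rightarrow> 'h endo" where
  "corner_op f = Endo (\<lambda>(v, r). (f (R v), 0))"

lemma linear_on_K:
  assumes "\<And>x y. x \<in> K \<Longrightarrow> y \<in> K \<Longrightarrow> f (x + y) = f x + f y"
    and "\<And>r x. x \<in> K \<Longrightarrow> f (r *\<^sub>R x) = r *\<^sub>R f x"
  shows "linear (\<lambda>(v, r :: real). (f (R v), 0 :: real))"
  by (rule linearI) (auto simp: linear_add[OF R_linear] linear_scale[OF R_linear] assms R_K)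

lemma app_corner_op:
  assumes "\<And>x y. x \<in> K \<Longrightarrow> y \<in> K \<Longrightarrow> f (x + y) = f x + f y"
    and "\<And>r x. x \<in> K \<Longrightarrow> f (r *\<^sub>R x) = r *\<^sub>R f x"
  shows "app (corner_op f) (v, r) = (f (R v), 0)"
  unfolding corner_op_def using Endo_inverse[of "\<lambda>(v, r). (f (R v), 0)"] linear_on_K[of f,
      OF assms] by simp

lemma app_corner_op_linear: "linear f \<Longrightarrow> app (corner_op f) (v, r) = (f (R v), 0)"
  by (rule app_corner_op) (simp_all add: linear_add linear_scale)

definition e :: "'h endo" where "e = corner_op (\<lambda>v. v)"

lemma app_e: "app e (v, r) = (R v, 0)"
  unfolding e_def by (rule app_corner_op_linear) (rule linear_ident)

lemma endo_eqI: "(\<And>v r. app x (v, r) = app y (v, r)) \<Longrightarrow> x = y"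
  unfolding app_inject[symmetric] by (rule ext) (simp add: split_paired_all)

text \<open>
  Outside the corner \<open>e\<close> the matrix \<open>u\<close> is the identity permutation, which makes its row and
  column sums equal to 1.
\<close>

definition u :: "4 \<Rightarrow> 4 \<Rightarrow> 'h endo" where
  "u i l = corner_op (M i l) + (if i = l then 1 - e else 0)"

lemma linear_M: "linear (M i l)"
  using M_bounded bounded_linear.linear by blast

lemma app_u: "app (u i l) (v, r) = (M i l (R v) + (if i = l then v - R v else 0),
    if i = l then r else 0)"
  by (auto simp: u_def plus_endo.rep_eq minus_endo.rep_eq one_endo.rep_eq zero_endo.rep_eq
      app_corner_op_linear[OF linear_M] app_e)

lemma R_M: "R (M i l (R v)) = M i l (R v)"
  by (intro R_id M_K R_K)

lemma app_sum: "app (sum f A) v = (\<Sum>x\<in>A. app (f x) v)"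
  by (induction A rule: infinite_finite_induct) (simp_all add: zero_endo.rep_eq plus_endo.rep_eq)

lemma magic_u: "magic u"
  unfolding magic_def
proof (intro conjI allI impI)
  note simps = times_endo.rep_eq app_u linear_add[OF R_linear] linear_diff[OF R_linear] R_M
      R_id[OF R_K] M_idem[OF R_K]
    linear_0[OF R_linear] linear_0[OF linear_M] zero_endo.rep_eq
  show "u i l * u i l = u i l" for i l
    by (rule endo_eqI) (auto simp: simps)
  show "u i l * u i k = 0" if "l \<noteq> k" for i l k
    using that by (intro endo_eqI) (auto simp: simps M_orth[OF R_K] zero_prod_def)
  show "u i l * u j l = 0" if "i \<noteq> j" for i j l
    using that by (intro endo_eqI) (auto simp: simps M_orth[OF R_K] zero_prod_def)
  show "sum (u i) UNIV = 1" for i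
    by (rule endo_eqI) (simp add: app_sum app_u one_endo.rep_eq sum_prod sum.distrib M_row[OF R_K])
  show "(\<Sum>i\<in>UNIV. u i l) = 1" for l
    by (rule endo_eqI) (simp add: app_sum app_u one_endo.rep_eq sum_prod sum.distrib M_col[OF R_K])
qed

section \<open>The bounded commutant on \<open>K\<close> and its vector state\<close>

definition ap :: "'h endo \<Rightarrow> 'h \<Rightarrow> 'h" where "ap y v = fst (app y (v, 0))"

text \<open>Commuting with \<open>e\<close> makes \<open>y\<close> preserve \<open>K\<close> while
  leaving its action off the corner free, so that \<open>1\<close> and the \<open>u i l\<close>
  belong to \<open>C\<close>. Boundedness allows passage to limits.\<close>

definition C :: "'h endo set" where
  "C = {y. e * y = y * e \<and> (\<exists>B. \<forall>v\<in>K. norm (ap y v) \<le> B * norm v) \<and>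
     (\<forall>j k. \<forall>v\<in>K. ap y (N j k v) = N j k (ap y v))}"

definition S :: "'h endo set" where
  "S = {y \<in> C. \<forall>v\<in>K. \<forall>w\<in>K. inner (ap y v) w = inner v (ap y w)}"

definition \<tau> :: "'h endo \<Rightarrow> real" where "\<tau> y = inner \<psi> (ap y \<psi>)"

lemma app_corner:
  assumes "e * y = y * e" "v \<in> K" shows "app y (v, 0) = (ap y v, 0)" "ap y v \<in> K"
proof -
  have "app y (v, 0) = app (y * e) (v, 0)" using assms(2)
      by (simp add: times_endo.rep_eq app_e R_id)
  also have "\<dots> = app (e * y) (v, 0)" by (simp add: assms(1))
  also have "\<dots> = (R (ap y v), 0)" unfolding times_endo.rep_eq ap_def by (cases
      "app y (v, 0)") (simp add: app_e)
  finally have *: "app y (v, 0) = (R (ap y v), 0)" .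
  have 1: "R (ap y v) = ap y v" using arg_cong[OF *, of fst] unfolding ap_def fst_conv by (rule sym)
  show "app y (v, 0) = (ap y v, 0)" using * unfolding 1 .
  show "ap y v \<in> K" using R_K[of "ap y v"] unfolding 1 .
qed

text \<open>The action on \<open>K\<close> does not determine an endomorphism, so equality is only
  obtained after multiplication by \<open>e\<close>.\<close>

lemma corner_eqI:
  assumes "e * x = x * e" "e * y = y * e" "\<And>v. v \<in> K \<Longrightarrow> ap x v = ap y v"
  shows "x * e = y * e"
  by (rule endo_eqI) (simp add: times_endo.rep_eq app_e app_corner[OF assms(1) R_K] app_corner[OF
      assms(2) R_K] assms(3)[OF R_K])

lemma ap_mult: "e * y = y * e \<Longrightarrow> v \<in> K \<Longrightarrow> ap (x * y) v = ap x (ap y v)"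
  by (simp only: ap_def[of "x * y"] ap_def[of x] times_endo.rep_eq app_corner(1))

lemma ap_add: "ap (x + y) v = ap x v + ap y v" and ap_uminus: "ap (- x) v = - ap x v"
  and ap_one: "ap 1 v = v"
  by (simp_all add: ap_def plus_endo.rep_eq uminus_endo.rep_eq one_endo.rep_eq)

lemma ap_linear: "linear (ap y)"
proof -
  have "linear (\<lambda>v :: 'h. (v, 0 :: real))" by (rule linearI) auto
  from linear_compose[OF linear_compose[OF this linear_app[of y]] linear_fst]
  show ?thesis by (simp add: ap_def[abs_def] o_def)
qed

lemma ap_u: "v \<in> K \<Longrightarrow> ap (u i l) v = M i l v"
  by (simp add: ap_def app_u R_id)

lemma one_C: "1 \<in> C"
  using N_K by (auto simp: C_def ap_def app_e one_endo.rep_eq R_id intro!: exI[of _ 1])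

lemma corner: "y \<in> C \<Longrightarrow> e * y = y * e"
  by (simp add: C_def)

lemma C_bound:
  assumes "y \<in> C" obtains B where "\<And>v. v \<in> K \<Longrightarrow> norm (ap y v) \<le> B * norm v" "B \<ge> 0"
proof -
  have "\<exists>B. \<forall>v\<in>K. norm (ap y v) \<le> B * norm v" using assms by (simp add: C_def)
  then obtain B where B: "\<And>v. v \<in> K \<Longrightarrow> norm (ap y v) \<le> B * norm v" by blast
  have "0 \<le> B" using order_trans[OF norm_ge_zero B[OF psi_K]] norm_psi by simp
  with B that show thesis by blast
qed

lemma C_N: "y \<in> C \<Longrightarrow> v \<in> K \<Longrightarrow> ap y (N j k v) = N j k (ap y v)"
  by (simp add: C_def)

lemma ap_K: "y \<in> C \<Longrightarrow> v \<in> K \<Longrightarrow> ap y v \<in> K"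
  using app_corner(2) corner by blast

lemma ap_times: "y \<in> C \<Longrightarrow> v \<in> K \<Longrightarrow> ap (x * y) v = ap x (ap y v)"
  using ap_mult corner by blast

lemma linear_N: "linear (N j k)"
  using N_bounded bounded_linear.linear by blast

lemma C_add: assumes "x \<in> C" "y \<in> C" shows "x + y \<in> C"
proof -
  obtain B where B: "\<And>v. v \<in> K \<Longrightarrow> norm (ap x v) \<le> B * norm v" using C_bound[OF assms(1)] by blast
  obtain D where D: "\<And>v. v \<in> K \<Longrightarrow> norm (ap y v) \<le> D * norm v" using C_bound[OF assms(2)] by blast
  have "norm (ap (x + y) v) \<le> (B + D) * norm v" if "v \<in> K" for v
    using B[OF that] D[OF that] norm_triangle_ineq[of "ap x v" "ap y v"]
        by (simp add: ap_add distrib_right)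
  moreover have "e * (x + y) = (x + y) * e"
    using assms by (simp add: distrib_left distrib_right corner)
  ultimately show ?thesis
    using assms by (auto simp: C_def ap_add linear_add[OF linear_N])
qed

lemma C_uminus: "x \<in> C \<Longrightarrow> - x \<in> C"
  by (auto simp: C_def ap_uminus linear_neg[OF linear_N])

lemma C_mult: assumes "x \<in> C" "y \<in> C" shows "x * y \<in> C"
proof -
  obtain B where B: "\<And>v. v \<in> K \<Longrightarrow> norm (ap x v) \<le> B * norm v" "B \<ge> 0" using C_bound[OF assms(1)]
      by blast
  obtain D where D: "\<And>v. v \<in> K \<Longrightarrow> norm (ap y v) \<le> D * norm v" using C_bound[OF assms(2)] by blast
  have "norm (ap (x * y) v) \<le> (B * D) * norm v" if "v \<in> K" for v
    using B(1)[OF ap_K[OF assms(2) that]] mult_left_mono[OF D[OF that] B(2)]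
    by (simp add: ap_times[OF assms(2) that] mult.assoc)
  moreover have "e * (x * y) = (x * y) * e"
    using corner[OF assms(1)] corner[OF assms(2)] by (metis mult.assoc)
  ultimately show ?thesis
    using assms by (auto simp: C_def[THEN eqset_imp_iff, of "x * y"] ap_times N_K C_N ap_K)
qed

lemma S_sym: "y \<in> S \<Longrightarrow> v \<in> K \<Longrightarrow> w \<in> K \<Longrightarrow> inner (ap y v) w = inner v (ap y w)"
  and S_C: "y \<in> S \<Longrightarrow> y \<in> C"
  by (auto simp: S_def)

lemma u_S: "u i l \<in> S"
proof -
  obtain B where B: "\<And>v. norm (M i l v) \<le> norm v * B"
    using bounded_linear.bounded[OF M_bounded] by blast
  have "e * u i l = u i l * e"
    by (rule endo_eqI) (simp add: times_endo.rep_eq app_e app_u R_id[OF R_K] R_M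
       linear_add[OF R_linear] linear_diff[OF R_linear] linear_0[OF R_linear])
  then show ?thesis
    using B N_K by (auto simp: S_def C_def ap_u M_sym MN mult.commute[of B] intro!: exI[of _ B])
qed

lemma ap_pow_C:
  assumes "a \<in> C" shows "a * a \<in> C" "(a * a) ^ m \<in> C" "v \<in> K
      \<Longrightarrow> ap ((a * a) ^ m) v = (ap a ^^ (2 * m)) v"
proof -
  show aa: "a * a \<in> C" by (rule C_mult[OF assms assms])
  have pow: "(a * a) ^ m \<in> C" for m by (induction m) (simp_all add: one_C C_mult aa)
  then show "(a * a) ^ m \<in> C" .
  show "v \<in> K \<Longrightarrow> ap ((a * a) ^ m) v = (ap a ^^ (2 * m)) v"
  proof (induction m)
    case (Suc m)
    have "(ap a ^^ k) v \<in> K" for k by (induction k) (simp_all add: Suc.prems ap_K assms)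
    with Suc show ?case using pow assms by (simp add: ap_times)
  qed (simp add: ap_one)
qed

text \<open>On \<open>K\<close> the sum of squares makes \<open>a\<close> a symmetric contraction.
  \<open>E\<close> is the pointwise limit \<open>L\<close> of its even powers, placed in the corner;
  commutation, symmetry and the values of \<open>\<tau>\<close> pass to this limit.\<close>

lemma support_ex:
  assumes S: "a \<in> S" "b \<in> S" "d \<in> S" and one: "a * a + b * b + d * d = 1"
  shows "\<exists>E\<in>S. E * E = E \<and> a * a * E = E \<and> E * e = E \<and>
        (\<forall>b\<in>S. \<forall>d\<in>S. a * a + b * b + d * d = 1 \<longrightarrow> b * E = 0) \<and>
        (\<forall>y\<in>C. a * a * y = y * (a * a) \<longrightarrow> E * y = y * E) \<and>
        (\<forall>y\<in>C. a * a * y = y \<longrightarrow> y * e = y \<longrightarrow> E * y = y) \<and>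
        (\<forall>y\<in>C. (\<forall>m. \<tau> ((a * a) ^ m * y) = \<tau> y) \<longrightarrow> \<tau> (E * y) = \<tau> y)"
proof -
  have aC: "a \<in> C" by (rule S_C[OF S(1)])
  have pyth: "(norm (ap a v))\<^sup>2 + (norm (ap b v))\<^sup>2 + (norm (ap d v))\<^sup>2 = (norm v)\<^sup>2"
    if "b \<in> S" "d \<in> S" "a * a + b * b + d * d = 1" "v \<in> K" for b d v
  proof -
    have "(norm v)\<^sup>2 = inner v (ap (a * a + b * b + d * d) v)"
      by (simp add: that(3) ap_one power2_norm_eq_inner)
    also have "\<dots> = inner (ap a v) (ap a v) + inner (ap b v) (ap b v) + inner (ap d v) (ap d v)"
      using that(1,2,4) S(1) by (simp only: ap_add inner_add_right ap_times S_C S_sym ap_K)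
    finally show ?thesis by (simp only: power2_norm_eq_inner)
  qed
  let ?A = "ap a"
  have contr: "norm (?A v) \<le> norm v" if "v \<in> K" for v
  proof (rule power2_le_imp_le)
    show "(norm (?A v))\<^sup>2 \<le> (norm v)\<^sup>2"
      using pyth[OF S(2,3) one that] zero_le_power2[of "norm (ap b v)"] zero_le_power2[of
          "norm (ap d v)"] by linarith
  qed simp
  have A_K: "?A v \<in> K" if "v \<in> K" for v by (rule ap_K[OF aC that])
  have pow_K: "(?A ^^ k) v \<in> K" if "v \<in> K" for k v by (induction k) (use that A_K in auto)
  \<comment> \<open>Outside \<open>K\<close> the limit need not exist and \<open>L v\<close> is then
    unspecified; \<open>corner_op\<close> evaluates \<open>L\<close> only at points of
    \<open>K\<close>.\<close>
  define L where "L v = lim (\<lambda>m. (?A ^^ (2 * m)) v)" for v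
  have lim: "(\<lambda>m. (?A ^^ (2 * m)) v) \<longlonglongrightarrow> L v" if "v \<in> K" for v
    using symmetric_contraction_powers_convergent[of K ?A v, OF A_K S_sym[OF S(1)] contr that]
    unfolding L_def convergent_LIMSEQ_iff by blast
  have L_K: "L v \<in> K" if "v \<in> K" for v
    by (rule closed_sequentially[OF K_closed _ lim[OF that]]) (rule pow_K[OF that])
  have lin_pow: "linear (?A ^^ k)" for k
    by (induction k) (use linear_compose[OF _ ap_linear] in \<open>auto simp: linear_ident id_def o_def\<close>)
  have L_add: "L (x + y) = L x + L y" if "x \<in> K" "y \<in> K" for x y
    by (rule LIMSEQ_unique[OF lim[OF subspace_add[OF K_subspace that]]])
      (unfold linear_add[OF lin_pow], intro tendsto_add lim that)
  have L_scale: "L (r *\<^sub>R x) = r *\<^sub>R L x" if "x \<in> K" for x r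
    by (rule LIMSEQ_unique[OF lim[OF subspace_scale[OF K_subspace that]]])
      (unfold linear_scale[OF lin_pow], intro tendsto_scaleR tendsto_const lim that)
  define E where "E = corner_op L"
  have app_E: "app E (v, r) = (L (R v), 0)" for v r
    unfolding E_def by (rule app_corner_op) (simp_all add: L_add L_scale)
  have ap_E: "ap E v = L v" if "v \<in> K" for v by (simp add: ap_def app_E R_id that)
  have eE: "e * E = E" and Ee: "E * e = E"
    by (rule endo_eqI; simp add: times_endo.rep_eq app_E app_e R_id[OF R_K] R_id[OF L_K[OF R_K]])+
  have L_bound: "norm (L v) \<le> norm v" if "v \<in> K" for v
  proof (rule Lim_bounded)
    show "(\<lambda>m. norm ((?A ^^ (2 * m)) v)) \<longlonglongrightarrow> norm (L v)" by (rule tendsto_norm[OF lim[OF that]])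
    have "norm ((?A ^^ k) v) \<le> norm v" for k
      by (induction k) (use contr[OF pow_K[OF that]] order_trans in \<open>auto\<close>)
    then show "\<forall>m\<ge>0. norm ((?A ^^ (2 * m)) v) \<le> norm v" by blast
  qed
  have map_lim: "(\<lambda>m. ap y ((?A ^^ (2 * m)) v)) \<longlonglongrightarrow> ap y (L v)" if y: "y \<in> C" and v: "v \<in> K" for y v
  proof -
    obtain B where B: "\<And>v. v \<in> K \<Longrightarrow> norm (ap y v) \<le> B * norm v" using C_bound[OF y] by blast
    have "(\<lambda>m. ap y ((?A ^^ (2 * m)) v) - ap y (L v)) \<longlonglongrightarrow> 0"
    proof (rule Lim_null_comparison)
      show "\<forall>\<^sub>F m in sequentially. norm (ap y ((?A ^^ (2 * m)) v) - ap y (L v)) \<le> B * norm ((?A ^^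
          (2 * m)) v - L v)"
        using B[OF subspace_diff[OF K_subspace pow_K[OF v] L_K[OF v]]]
        by (simp add: linear_diff[OF ap_linear])
      have "(\<lambda>m. B * norm ((?A ^^ (2 * m)) v - L v)) \<longlonglongrightarrow> B * norm (L v - L v)"
        by (intro tendsto_intros lim v)
      then show "(\<lambda>m. B * norm ((?A ^^ (2 * m)) v - L v)) \<longlonglongrightarrow> 0" by simp
    qed
    then show ?thesis by (rule LIM_zero_cancel)
  qed
  have E_C: "E \<in> C"
  proof -
    have "L (N j k v) = N j k (L v)" if "v \<in> K" for j k v
    proof (rule LIMSEQ_unique)
      show "(\<lambda>m. (?A ^^ (2 * m)) (N j k v)) \<longlonglongrightarrow> L (N j k v)" by (rule lim[OF N_K[OF that]])
      have "(?A ^^ k') (N j k v) = N j k ((?A ^^ k') v)" for k'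
        by (induction k') (use C_N[OF aC pow_K[OF that]] in auto)
      then show "(\<lambda>m. (?A ^^ (2 * m)) (N j k v)) \<longlonglongrightarrow> N j k (L v)"
        using bounded_linear.tendsto[OF N_bounded lim[OF that]] by simp
    qed
    then show ?thesis
      using L_bound eE Ee by (auto simp: C_def ap_E N_K intro!: exI[of _ 1])
  qed
  have pow_sym: "inner ((?A ^^ k) w) w' = inner w ((?A ^^ k) w')" if "w \<in> K" "w' \<in> K" for k w w'
    using that by (induction k arbitrary: w w') (simp_all add: S_sym[OF S(1)] pow_K A_K
        funpow_swap1)
  have E_S: "E \<in> S"
  proof -
    have "inner (L v) w = inner v (L w)" if "v \<in> K" "w \<in> K" for v w
      by (rule LIMSEQ_unique[OF tendsto_inner[OF lim[OF that(1)] tendsto_const]])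
        (use tendsto_inner[OF tendsto_const lim[OF that(2)], of v] that in \<open>simp add: pow_sym\<close>)
    then show ?thesis using E_C by (simp add: S_def ap_E)
  qed
  \<comment> \<open>Applying \<open>a * a\<close> shifts the sequence of even powers by one
    index.\<close>
  have AAL: "?A (?A (L v)) = L v" if "v \<in> K" for v
  proof (rule LIMSEQ_unique)
    show "(\<lambda>m. (?A ^^ (2 * Suc m)) v) \<longlonglongrightarrow> L v" by (rule LIMSEQ_Suc[OF lim[OF that]])
    show "(\<lambda>m. (?A ^^ (2 * Suc m)) v) \<longlonglongrightarrow> ?A (?A (L v))"
      using map_lim[OF C_mult[OF aC aC] that] by (simp add: ap_times aC pow_K L_K that)
  qed
  have L_fix: "L v = v" if "?A (?A v) = v" "v \<in> K" for v
  proof -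
    have "(?A ^^ (2 * m)) v = v" for m by (induction m) (simp_all add: that funpow_swap1)
    then show ?thesis using lim[OF that(2)] by (simp add: LIMSEQ_const_iff)
  qed
  show ?thesis
  proof (intro bexI[of _ E] conjI ballI impI)
    show "E * E = E"
      by (rule endo_eqI) (simp add: times_endo.rep_eq app_E R_id L_K R_K L_fix[OF AAL])
    have *: "e * (a * a * E) = a * a * E * e" "e * E = E * e"
      using corner[OF C_mult[OF C_mult[OF aC aC] E_C]] eE Ee by simp_all
    have "a * a * E * e = E * e"
      by (rule corner_eqI[OF *]) (simp add: ap_times E_C aC ap_E L_K AAL mult.assoc C_mult)
    then show "a * a * E = E" using Ee by (simp add: mult.assoc)
    show "E * e = E" by (rule Ee)
    show "b * E = 0" if "b \<in> S" "d \<in> S" "a * a + b * b + d * d = 1" for b d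
    proof -
      have "ap b (L v) = 0" if "v \<in> K" for v
      proof -
        \<comment> \<open>By \<open>AAL\<close> and symmetry \<open>a\<close> preserves the norm of
          \<open>L v\<close>, so in the Pythagorean identity nothing is left for \<open>b\<close>
          and \<open>d\<close>.\<close>
        have "(norm (?A (L v)))\<^sup>2 = (norm (L v))\<^sup>2"
          using S_sym[OF S(1) L_K[OF that] A_K[OF L_K[OF that]]] AAL[OF that]
              by (simp add: power2_norm_eq_inner)
        then have "(norm (ap b (L v)))\<^sup>2 + (norm (ap d (L v)))\<^sup>2 = 0"
          using pyth[OF \<open>b \<in> S\<close> \<open>d \<in> S\<close> \<open>a * a + b * b + d * d = 1\<close> L_K[OF that]] by simp
        then show ?thesis by (simp add: add_nonneg_eq_0_iff)
      qed
      then have "b * E * e = 0 * e"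
        by (intro corner_eqI) (simp_all add: corner C_mult S_C that E_C ap_times ap_E ap_def[of 0]
            zero_endo.rep_eq)
      then show ?thesis using Ee by (simp add: mult.assoc)
    qed
    show "E * y = y * E" if y: "y \<in> C" and comm: "a * a * y = y * (a * a)" for y
    proof -
      have aay: "?A (?A (ap y v)) = ap y (?A (?A v))" if "v \<in> K" for v
        using arg_cong[OF comm, of "\<lambda>z. ap z v"] that
            by (simp add: ap_times aC y A_K C_mult mult.assoc ap_K)
      have pow: "(?A ^^ (2 * m)) (ap y v) = ap y ((?A ^^ (2 * m)) v)" if "v \<in> K" for m v
        by (induction m) (simp_all add: aay pow_K that)
      have "L (ap y v) = ap y (L v)" if "v \<in> K" for v
        by (rule LIMSEQ_unique[OF lim[OF ap_K[OF y that]]]) (use map_lim[OF y that] in \<open>simp add: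
            pow that\<close>)
      then have "E * y * e = y * E * e"
        by (intro corner_eqI) (simp_all add: corner C_mult y E_C ap_times ap_E ap_K)
      moreover have "E * y * e = E * y" using corner[OF y] Ee by (metis mult.assoc)
      ultimately show ?thesis using Ee by (simp add: mult.assoc)
    qed
    show "E * y = y" if y: "y \<in> C" and absorb: "a * a * y = y" and ye: "y * e = y" for y
    proof -
      have "?A (?A (ap y v)) = ap y v" if "v \<in> K" for v
        using arg_cong[OF absorb, of "\<lambda>z. ap z v"] that
            by (simp add: ap_times aC y ap_K mult.assoc C_mult)
      then have "E * y * e = y * e"
        by (intro corner_eqI) (simp_all add: corner C_mult y E_C ap_times ap_E ap_K L_fix)
      then show ?thesis by (simp add: mult.assoc ye)
    qed
    show "\<tau> (E * y) = \<tau> y" if y: "y \<in> C" and const: "\<forall>m. \<tau> ((a * a) ^ m * y) = \<tau> y" for y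
    proof (rule LIMSEQ_unique)
      show "(\<lambda>m. \<tau> y) \<longlonglongrightarrow> \<tau> y" by simp
      have "\<tau> ((a * a) ^ m * y) = inner \<psi> ((?A ^^ (2 * m)) (ap y \<psi>))" for m
        unfolding \<tau>_def using y by (simp add: ap_times ap_pow_C[OF aC] ap_K psi_K)
      then show "(\<lambda>m. \<tau> y) \<longlonglongrightarrow> \<tau> (E * y)"
        using tendsto_inner[OF tendsto_const lim[OF ap_K[OF y psi_K]], of \<psi>] const
        by (simp add: \<tau>_def ap_times y psi_K ap_E ap_K)
    qed
  qed (rule E_S)
qed

lemma ap_scaleR: "ap (r *\<^sub>R x) v = r *\<^sub>R ap x v"
  by (simp add: ap_def scaleR_endo.rep_eq)

lemma S_mult:
  assumes "x \<in> S" "y \<in> S" "x * y = y * x" shows "x * y \<in> S"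
proof -
  have "inner (ap (x * y) v) w = inner v (ap (x * y) w)" if "v \<in> K" "w \<in> K" for v w
  proof -
    have "inner (ap (x * y) v) w = inner v (ap (y * x) w)"
      using assms(1,2) that by (simp add: ap_times S_C S_sym ap_K)
    then show ?thesis by (simp add: assms(3))
  qed
  then show ?thesis using assms by (simp add: S_def C_mult)
qed

text \<open>The trace property uses \<open>M i j \<psi> = N i j \<psi>\<close>: the operator
  \<open>M i j\<close> is moved to the vector on the left, replaced by \<open>N i j\<close>, carried
  through \<open>y\<close> in the commutant, and replaced back. The sandwich is the squared norm of
  \<open>y\<close> applied to \<open>x \<psi>\<close>; reversal is symmetry of the real inner
  product.\<close>

lemma magic_trace: "magic_trace u \<tau> C S e"
proof (rule magic_trace.intro)
  show "linear \<tau>"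
    by (rule linearI) (simp_all add: \<tau>_def ap_add ap_scaleR inner_add_right)
  show "\<tau> 1 = 1" using norm_psi by (simp add: \<tau>_def ap_one flip: power2_norm_eq_inner)
  show "1 \<in> S" by (simp add: S_def one_C ap_one)
  show "x + y \<in> S" if "x \<in> S" "y \<in> S" for x y
    using that by (simp add: S_def C_add ap_add inner_add_left inner_add_right)
  show "- x \<in> S" if "x \<in> S" for x
    using that by (simp add: S_def C_uminus ap_uminus)
  show "0 \<le> \<tau> (x * (y * y) * x)" if "x \<in> S" "y \<in> S" for x y
  proof -
    have "\<tau> (x * (y * y) * x) = inner \<psi> (ap x (ap y (ap y (ap x \<psi>))))"
      using that psi_K by (simp add: \<tau>_def ap_times S_C ap_K C_mult)
    also have "\<dots> = inner (ap y (ap x \<psi>)) (ap y (ap x \<psi>))"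
      using that psi_K by (simp add: S_C ap_K flip: S_sym)
    finally show ?thesis by simp
  qed
  show "\<tau> (x * y * z) = \<tau> (z * y * x)" if "x \<in> S" "y \<in> S" "z \<in> S" for x y z
  proof -
    have "\<tau> (x * y * z) = inner (ap z (ap y (ap x \<psi>))) \<psi>"
      using that psi_K by (simp add: \<tau>_def ap_times S_C ap_K C_mult S_sym)
    also have "\<dots> = \<tau> (z * y * x)"
      using that psi_K by (simp add: \<tau>_def ap_times S_C ap_K C_mult inner_commute)
    finally show ?thesis .
  qed
  show "\<tau> (u i j * y) = \<tau> (y * u i j)" if "y \<in> C" for i j y
  proof -
    have "\<tau> (u i j * y) = inner (M i j \<psi>) (ap y \<psi>)"
      using that psi_K by (simp add: \<tau>_def ap_times ap_K ap_u M_sym)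
    also have "\<dots> = inner \<psi> (ap y (N i j \<psi>))"
      using that psi_K by (simp add: M_psi N_sym C_N)
    also have "\<dots> = \<tau> (y * u i j)"
      using that psi_K by (simp add: \<tau>_def ap_times S_C u_S ap_u M_psi)
    finally show ?thesis .
  qed
qed (fact magic_u C_add C_mult S_C u_S S_mult support_ex)+

lemma classical:
  assumes "\<And>l k i j. p $ (l, k, i, j) = inner \<psi> (M i l (N j k \<psi>))"
  shows "p \<in> classical_correlations"
proof (rule magic_trace.classical[OF magic_trace])
  fix l k i j
  show "p $ (l, k, i, j) = \<tau> (u i l * u j k)"
    using psi_K by (simp add: assms \<tau>_def ap_times S_C u_S ap_u M_psi ap_K N_K)
qed

end

section \<open>From a quantum strategy to the operators on \<open>K\<close>\<close>

lemma positive_operator_bounded_linear: "positive_operator A \<Longrightarrow> bounded_linear A"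
  by (simp add: positive_operator_def bounded_clinear_def)

lemma positive_operator_inner:
  assumes "positive_operator A" shows "0 \<le> inner x (A x)"
  using assms nonneg_Reals_cases[of "cinner x (A x)"]
      unfolding positive_operator_def Re_cinner[symmetric]
  by (metis complex_nonneg_Reals_iff)

lemma cinner_add_left: "cinner (x + y) z = cinner x z + cinner y (z :: 'h::chilbert_space)"
  by (metis cinner_add_right cinner_commute complex_cnj_add)

lemma cinner_scaleC_left: "cinner (c *\<^sub>C x) y = cnj c * cinner x (y :: 'h::chilbert_space)"
  by (metis cinner_scaleC_right cinner_commute complex_cnj_mult)

text \<open>Polarization: the quadratic form is real at \<open>x\<close>, at \<open>y\<close> and at
  \<open>x + \<i> *\<^sub>C y\<close>, so the imaginary part of the cross terms vanishes.\<close>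

lemma positive_operator_symmetric:
  assumes "positive_operator A" shows "inner (A x) y = inner x (A y)"
proof -
  have Im: "Im (cinner z (A z)) = 0" for z
    using assms by (auto simp: positive_operator_def complex_nonneg_Reals_iff)
  have "A (x + \<i> *\<^sub>C y) = A x + \<i> *\<^sub>C A y"
    using assms linear_add[OF bounded_linear.linear[OF positive_operator_bounded_linear[OF assms]]]
    by (simp add: positive_operator_def bounded_clinear_def)
  then have "Re (cinner x (A y)) = Re (cinner y (A x))"
    using Im[of "x + \<i> *\<^sub>C y"] Im[of x] Im[of y]
    by (simp add: cinner_add_left cinner_add_right cinner_scaleC_left cinner_scaleC_right)
  then show ?thesis by (simp add: Re_cinner inner_commute)
qed

lemma quantum_subset_classical:
  "quantum_correlations TYPE('h::chilbert_space) \<subseteq> (classical_correlations :: 4 corr set)"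
proof
  fix p :: "4 corr" assume "p \<in> quantum_correlations TYPE('h)"
  then obtain \<psi> :: 'h and M N :: "4 \<Rightarrow> 4 \<Rightarrow> 'h \<Rightarrow> 'h"
    where corr: "correlation p" "winning p" and psi: "norm \<psi> = 1"
    and Mpos: "\<And>i l. positive_operator (M i l)" and Npos: "\<And>i l. positive_operator (N i l)"
    and Msum: "\<And>i x. (\<Sum>l\<in>UNIV. M i l x) = x" and Nsum: "\<And>i x. (\<Sum>l\<in>UNIV. N i l x) = x"
    and comm: "\<And>i j k l. M i l \<circ> N j k = N j k \<circ> M i l"
    and p_eq: "\<And>l k i j. complex_of_real (p $ (l, k, i, j)) = cinner \<psi> (M i l (N j k \<psi>))"
    unfolding quantum_correlations_def by blast
  note M_bl = positive_operator_bounded_linear[OF Mpos]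
      and N_bl = positive_operator_bounded_linear[OF Npos]
  note M_lin = bounded_linear.linear[OF M_bl] and N_lin = bounded_linear.linear[OF N_bl]
  note M_sym = positive_operator_symmetric[OF Mpos] and N_sym = positive_operator_symmetric[OF Npos]
  have MN: "M i l (N j k v) = N j k (M i l v)" for i l j k v
    using fun_cong[OF comm, of i l j k v] by simp
  have p: "p $ (l, k, i, j) = inner \<psi> (M i l (N j k \<psi>))" for l k i j
    using arg_cong[OF p_eq, of Re] by (simp add: Re_cinner)
  have le_id: "inner y (A i l y) \<le> inner y y"
    if pos: "\<And>i l. positive_operator (A i l)" and sum: "\<And>i x. (\<Sum>l\<in>UNIV. A i l x) = x"
    for A :: "4 \<Rightarrow> 4 \<Rightarrow> 'h \<Rightarrow> 'h" and i l y
  proof -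
    have "inner y (A i l y) \<le> (\<Sum>l\<in>UNIV. inner y (A i l y))"
      by (rule member_le_sum) (simp_all add: positive_operator_inner[OF pos])
    then show ?thesis by (simp add: sum flip: inner_sum_right)
  qed
  \<comment> \<open>The inequality between the square of \<open>A i l\<close> and
    \<open>A i l\<close>, as quadratic forms: positivity is applied to \<open>x - A i l x\<close>
    and \<open>le_id\<close> bounds the cubic term.\<close>
  have contraction: "(norm (A i l x))\<^sup>2 \<le> inner x (A i l x)"
    if pos: "\<And>i l. positive_operator (A i l)" and sum: "\<And>i x. (\<Sum>l\<in>UNIV. A i l x) = x"
    for A :: "4 \<Rightarrow> 4 \<Rightarrow> 'h \<Rightarrow> 'h" and i l x
  proof -
    have lin: "linear (A i l)" using positive_operator_bounded_linear[OF pos]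
        bounded_linear.linear by blast
    have "0 \<le> inner (x - A i l x) (A i l (x - A i l x))" by (rule positive_operator_inner[OF pos])
    also have "\<dots> = inner x (A i l x) - 2 * inner (A i l x) (A i l x) + inner (A i l x) (A i l (A i
        l x))"
      using positive_operator_symmetric[OF pos, of i l x "A i l x"]
      by (simp add: linear_diff[OF lin] inner_diff_left inner_diff_right inner_commute)
    finally show ?thesis using le_id[of A "A i l x" i l, OF pos sum]
        by (simp add: power2_norm_eq_inner)
  qed
  note Mc = contraction[of M, OF Mpos Msum] and Nc = contraction[of N, OF Npos Nsum]
  have win: "p $ (l, k, i, j) = 0" if "(i = j) \<noteq> (l = k)" for l k i j
    using corr(2) that by (auto simp: winning_def)
  have diag: "(\<Sum>l\<in>UNIV. inner (M i l \<psi>) (N i l \<psi>)) = 1" for i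
  proof -
    have "1 = (\<Sum>l\<in>UNIV. \<Sum>k\<in>UNIV. p $ (l, k, i, i))" using corr(1) by (simp add: correlation_def)
    also have "\<dots> = (\<Sum>l\<in>UNIV. p $ (l, l, i, i))"
    proof (rule sum.cong[OF refl])
      fix l
      have "(\<Sum>k\<in>UNIV. p $ (l, k, i, i)) = (\<Sum>k\<in>UNIV. if k = l then p $ (l, l, i, i) else 0)"
        by (rule sum.cong) (auto simp: win)
      then show "(\<Sum>k\<in>UNIV. p $ (l, k, i, i)) = p $ (l, l, i, i)" by simp
    qed
    finally show ?thesis by (simp add: p M_sym)
  qed
  have sum_M: "(\<Sum>l\<in>UNIV. inner \<psi> (M i l \<psi>)) = 1" and sum_N: "(\<Sum>l\<in>UNIV. inner \<psi> (N i l \<psi>)) = 1" for i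
    using psi by (simp_all add: Msum Nsum flip: inner_sum_right power2_norm_eq_inner)
  have M_N: "M i l \<psi> = N i l \<psi>" and M_norm: "(norm (M i l \<psi>))\<^sup>2 = inner \<psi> (M i l \<psi>)" for i l
  proof -
    \<comment> \<open>A sum of three nonnegative terms whose total over all answers is 1 + 1 - 2 =
      0, by \<open>diag\<close>. Hence each term vanishes.\<close>
    let ?d = "\<lambda>l. inner \<psi> (M i l \<psi>) - (norm (M i l \<psi>))\<^sup>2 + (inner \<psi> (N i l \<psi>) - (norm (N i l \<psi>))\<^sup>2)
       + (norm (M i l \<psi> - N i l \<psi>))\<^sup>2"
    have "?d l = inner \<psi> (M i l \<psi>) + inner \<psi> (N i l \<psi>) - 2 * inner (M i l \<psi>) (N i l \<psi>)" for l
      by (simp add: power2_norm_eq_inner inner_diff_left inner_diff_right inner_commute)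
    then have "sum ?d UNIV = 0"
      using sum_M[of i] sum_N[of i] diag[of i] by (simp only: sum.distrib sum_subtractf flip:
          sum_distrib_left)
    then have "\<forall>l\<in>UNIV. ?d l = 0"
      using Mc[of i _ \<psi>] Nc[of i _ \<psi>] by (subst (asm) sum_nonneg_eq_0_iff) simp_all
    then have "?d l = 0" by blast
    then have "(norm (M i l \<psi> - N i l \<psi>))\<^sup>2 = 0" "(norm (M i l \<psi>))\<^sup>2 = inner \<psi> (M i l \<psi>)"
      using Mc[of i l \<psi>] Nc[of i l \<psi>] zero_le_power2[of "norm (M i l \<psi> - N i l \<psi>)"] by linarith+
    then show "M i l \<psi> = N i l \<psi>" "(norm (M i l \<psi>))\<^sup>2 = inner \<psi> (M i l \<psi>)" by simp_all
  qed
  have M_idem: "M i l (M i l \<psi>) = M i l \<psi>" for i l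
  proof -
    \<comment> \<open>By \<open>M_norm\<close> and \<open>le_id\<close> the form of
      \<open>M i l\<close> is at most 0 at this vector, so \<open>contraction\<close> makes
      \<open>M i l\<close> annihilate it.\<close>
    let ?z = "\<psi> - M i l \<psi>"
    have "inner ?z (M i l ?z) = inner \<psi> (M i l \<psi>) - 2 * (norm (M i l \<psi>))\<^sup>2 + inner (M i l \<psi>) (M i
        l (M i l \<psi>))"
      using M_sym[of i l \<psi> "M i l \<psi>"]
      by (simp add: linear_diff[OF M_lin] inner_diff_left inner_diff_right inner_commute
          power2_norm_eq_inner)
    moreover have "inner (M i l \<psi>) (M i l (M i l \<psi>)) \<le> (norm (M i l \<psi>))\<^sup>2"
      using le_id[of M "M i l \<psi>" i l, OF Mpos Msum] by (simp add: power2_norm_eq_inner)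
    ultimately have "(norm (M i l ?z))\<^sup>2 \<le> 0" using Mc[of i l ?z] M_norm[of i l] by linarith
    then show ?thesis by (simp add: linear_diff[OF M_lin])
  qed
  have M_orth: "M i l (M j k \<psi>) = 0" if "(i = j) \<noteq> (l = k)" for i l j k
  proof -
    \<comment> \<open>Replacing \<open>M j k\<close> by \<open>N j k\<close> on both sides and
      commuting turns this into a losing probability; \<open>contraction\<close> then upgrades a
      vanishing form to a vanishing vector.\<close>
    have "inner (M j k \<psi>) (M i l (M j k \<psi>)) = inner \<psi> (M i l (N j k (N j k \<psi>)))"
      unfolding M_N by (simp add: N_sym MN)
    also have "N j k (N j k \<psi>) = N j k \<psi>" using M_idem[of j k] by (metis M_N MN)
    also have "inner \<psi> (M i l (N j k \<psi>)) = 0" using win[OF that] p by metis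
    finally show ?thesis using Mc[of i l "M j k \<psi>"] by simp
  qed
  have M_col: "(\<Sum>i\<in>UNIV. M i l \<psi>) = \<psi>" for l
  proof -
    let ?c = "\<lambda>l. \<Sum>i\<in>UNIV. M i l \<psi>"
    have "inner (M i l \<psi>) (M j l \<psi>) = (if i = j then inner \<psi> (M i l \<psi>) else 0)" for i j l
      using M_norm[of i l] by (auto simp: power2_norm_eq_inner M_sym M_orth)
    then have "inner (?c l) (?c l) = inner \<psi> (?c l)" for l
      by (simp add: inner_sum_left inner_sum_right)
    then have norm_diff: "(norm (?c l - \<psi>))\<^sup>2 = 1 - inner \<psi> (?c l)" for l
      using psi by (simp add: power2_norm_eq_inner inner_diff_left inner_diff_right inner_commute
          norm_eq_1)
    \<comment> \<open>Double counting: there are as many questions as answers, so the defects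
      \<open>1 - inner \<psi> (?c l)\<close>, which are squared norms, add up to 0.\<close>
    have "(\<Sum>l\<in>UNIV. inner \<psi> (?c l)) = (\<Sum>i\<in>UNIV. \<Sum>l\<in>UNIV. inner \<psi> (M i l \<psi>))"
      unfolding inner_sum_right by (rule sum.swap)
    then have "(\<Sum>l\<in>UNIV. (norm (?c l - \<psi>))\<^sup>2) = 0"
      unfolding norm_diff by (simp add: sum_subtractf sum_M)
    then have "\<forall>l\<in>UNIV. (norm (?c l - \<psi>))\<^sup>2 = 0"
      by (subst (asm) sum_nonneg_eq_0_iff) simp_all
    then show ?thesis by simp
  qed
  \<comment> \<open>The orbit of \<open>\<psi>\<close> under the commutant of the
    \<open>M i l\<close>. A relation between the \<open>M i l\<close> that holds at
    \<open>\<psi>\<close> holds on \<open>K0\<close> by commuting \<open>n\<close> to the left, and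
    on the closure by continuity.\<close>
  define K0 where "K0 = {n \<psi> | n. bounded_linear n \<and> (\<forall>i l v. n (M i l v) = M i l (n v))}"
  define K where "K = closure K0"
  have K0_I: "n \<psi> \<in> K0" if "bounded_linear n" "\<And>i l v. n (M i l v) = M i l (n v)" for n
    using that unfolding K0_def by blast
  have K0_E: thesis if "v \<in> K0" "\<And>n. bounded_linear n \<Longrightarrow> v = n \<psi>
      \<Longrightarrow> (\<And>i l w. M i l (n w) = n (M i l w)) \<Longrightarrow> thesis" for v thesis
    using that unfolding K0_def by auto
  have sub0: "subspace K0"
  proof (rule subspaceI)
    show "0 \<in> K0" by (rule K0_I[of "\<lambda>_. 0"]) (simp_all add: bounded_linear_zero linear_0[OF M_lin])
    show "x + y \<in> K0" if xy: "x \<in> K0" "y \<in> K0" for x y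
    proof -
      obtain n where n: "bounded_linear n" "x = n \<psi>" "\<And>i l w. M i l (n w) = n (M i l w)"
          by (rule K0_E[OF xy(1)], rule that)
      obtain m where m: "bounded_linear m" "y = m \<psi>" "\<And>i l w. M i l (m w) = m (M i l w)"
          by (rule K0_E[OF xy(2)], rule that)
      show ?thesis unfolding n(2) m(2)
        by (rule K0_I[of "\<lambda>v. n v + m v"]) (simp_all add: bounded_linear_add n(1,3) m(1,3)
            linear_add[OF M_lin])
    qed
    show "c *\<^sub>R x \<in> K0" if x: "x \<in> K0" for c x
    proof -
      obtain n where n: "bounded_linear n" "x = n \<psi>" "\<And>i l w. M i l (n w) = n (M i l w)"
          by (rule K0_E[OF x], rule that)
      show ?thesis unfolding n(2)
        by (rule K0_I[of "\<lambda>v. c *\<^sub>R n v"])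
          (simp_all add: bounded_linear_compose[OF bounded_linear_scaleR_right] n(1,3)
              linear_scale[OF M_lin])
    qed
  qed
  have closed_eq: "f v = g v" if "v \<in> K" "bounded_linear f" "bounded_linear g" "\<And>v. v \<in> K0
      \<Longrightarrow> f v = g v" for f g :: "'h \<Rightarrow> 'h" and v
  proof -
    have "closed {v. f v = g v}"
      by (intro closed_Collect_eq linear_continuous_on that)
    then have "K \<subseteq> {v. f v = g v}" unfolding K_def using that(4) by (intro closure_minimal) auto
    then show ?thesis using that(1) by blast
  qed
  have lin_K: "f v \<in> K" if "v \<in> K" "bounded_linear f" "\<And>v. v \<in> K0 \<Longrightarrow> f v \<in> K0" for f v
    using closure_bounded_linear_image_subset[OF that(2), of K0] closure_mono[of
        "f ` K0" K0] that(1,3)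
    unfolding K_def by blast
  have subK: "subspace K"
  proof (rule subspaceI)
    show "0 \<in> K" using subspace_0[OF sub0] closure_subset[of K0] by (auto simp: K_def)
    show "x + y \<in> K" if xy: "x \<in> K" "y \<in> K" for x y
    proof -
      obtain f g where "\<And>n. f n \<in> K0" "f \<longlonglongrightarrow> x" "\<And>n. g n \<in> K0" "g \<longlonglongrightarrow> y"
        using xy unfolding K_def closure_sequential by blast
      then have "(\<forall>n. f n + g n \<in> K0) \<and> (\<lambda>n. f n + g n) \<longlonglongrightarrow> x + y"
        by (intro conjI allI tendsto_add subspace_add[OF sub0])
      then show ?thesis unfolding K_def closure_sequential by (rule exI[of _ "\<lambda>n. f n + g n"])
    qed
    show "c *\<^sub>R x \<in> K" if "x \<in> K" for c x
      by (rule lin_K[OF that bounded_linear_scaleR_right]) (rule subspace_scale[OF sub0])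
  qed
  \<comment> \<open>A purely algebraic projection onto \<open>K\<close>; continuity is not
    claimed.\<close>
  obtain R where R: "linear R" "\<And>v. R v \<in> K" "\<And>v. v \<in> K \<Longrightarrow> R v = v"
    using linear_exists_left_inverse_on[OF linear_ident subK] by (auto simp: image_subset_iff)
  have "hilbert_model K R \<psi> M N"
  proof (rule hilbert_model.intro)
    show "closed K" by (simp add: K_def)
    show "\<psi> \<in> K"
      using K0_I[OF bounded_linear_ident] closure_subset[of K0] by (auto simp: K_def)
    show "M i l v \<in> K" if "v \<in> K" for i l v
    proof (rule lin_K[OF that M_bl])
      fix v assume "v \<in> K0"
      then obtain n where n: "v = n \<psi>" "bounded_linear n" "\<And>i l v. n (M i l v) = M i l (n v)"
          unfolding K0_def by blast
      \<comment> \<open>\<open>M i l (n \<psi>) = n (N i l \<psi>)\<close>, and \<open>n\<close>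
        followed after \<open>N i l\<close> again commutes with every \<open>M j k\<close>.\<close>
      have "(\<lambda>v. n (N i l v)) \<psi> \<in> K0"
        by (rule K0_I) (simp_all add: bounded_linear_compose[OF n(2) N_bl] n(3) flip: MN)
      then show "M i l v \<in> K0" by (simp add: n(1) M_N flip: n(3))
    qed
    show "N i l v \<in> K" if "v \<in> K" for i l v
    proof (rule lin_K[OF that N_bl])
      fix v assume "v \<in> K0"
      then obtain n where n: "v = n \<psi>" "bounded_linear n" "\<And>i l v. n (M i l v) = M i l (n v)"
          unfolding K0_def by blast
      have "(\<lambda>v. N i l (n v)) \<psi> \<in> K0"
        by (rule K0_I) (simp_all add: bounded_linear_compose[OF N_bl n(2)] n(3) MN)
      then show "N i l v \<in> K0" by (simp add: n(1))
    qed
    show "M i l (M i l v) = M i l v" if "v \<in> K" for i l v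
      by (rule closed_eq[OF that bounded_linear_compose[OF M_bl M_bl] M_bl]) (erule K0_E, simp
          only: M_idem)
    show "M i l (M j k v) = 0" if "v \<in> K" "(i = j) \<noteq> (l = k)" for i l j k v
      by (rule closed_eq[OF that(1) bounded_linear_compose[OF M_bl M_bl] bounded_linear_zero])
        (erule K0_E, simp only: M_orth[OF that(2)] linear_0[OF bounded_linear.linear])
    show "(\<Sum>i\<in>UNIV. M i l v) = v" if "v \<in> K" for l v
    proof (rule closed_eq[OF that bounded_linear_sum[OF M_bl] bounded_linear_ident])
      fix v assume v: "v \<in> K0"
      obtain n where n: "bounded_linear n" "v = n \<psi>" "\<And>i l w. M i l (n w) = n (M i l w)"
          by (rule K0_E[OF v], rule that)
      show "(\<Sum>i\<in>UNIV. M i l v) = v"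
        unfolding n(2,3) linear_sum[OF bounded_linear.linear[OF n(1)], symmetric] M_col ..
    qed
    show "(\<Sum>l\<in>UNIV. M i l v) = v" for i v by (rule Msum)
  qed (fact subK psi R M_bl N_bl M_sym N_sym MN M_N)+
  then show "p \<in> classical_correlations" by (rule hilbert_model.classical) (rule p)
qed

section \<open>Classical correlations as quantum correlations\<close>

lift_definition diag :: "(nat \<Rightarrow> bool) \<Rightarrow> ell2 \<Rightarrow> ell2" is "\<lambda>P f n. if P n then f n else 0"
  by (rule summable_comparison_test'[where N = 0]) auto

lemma norm_diag_le: "norm (diag P x) \<le> norm x"
  unfolding norm_ell2_eq real_sqrt_le_iff
  by (rule suminf_le[OF _ summable_coord summable_coord]) (simp add: diag.rep_eq)

lemma bounded_clinear_diag: "bounded_clinear (diag P)"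
  unfolding bounded_clinear_def
proof (intro conjI allI)
  show "bounded_linear (diag P)"
  proof (rule bounded_linear_intro[where K = 1])
    show "diag P (x + y) = diag P x + diag P y" for x y by transfer auto
    show "diag P (r *\<^sub>R x) = r *\<^sub>R diag P x" for r x unfolding scaleR_ell2_def by transfer auto
    show "norm (diag P x) \<le> norm x * 1" for x by (simp add: norm_diag_le)
  qed
  show "diag P (c *\<^sub>C x) = c *\<^sub>C diag P x" for c x unfolding scaleC_ell2_inst by transfer auto
qed

lemma cinner_diag: "cinner x (diag P x) = complex_of_real (\<Sum>n.
    if P n then (cmod (coord x n))\<^sup>2 else 0)"
proof -
  have "summable (\<lambda>n. if P n then (cmod (coord x n))\<^sup>2 else 0)"
    by (rule summable_comparison_test'[OF summable_coord[of x], where N = 0]) auto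
  moreover have "cnj (coord x n) * coord (diag P x) n = complex_of_real (if P n then (cmod (coord
      x n))\<^sup>2 else 0)" for n
    by (simp add: diag.rep_eq mult.commute[of "cnj _"] del: of_real_power flip: complex_norm_square)
  ultimately show ?thesis
    by (simp only: cinner_ell2_inst cinner_ell2_def suminf_of_real)
qed

lemma positive_operator_diag: "positive_operator (diag P)"
  unfolding positive_operator_def cinner_diag
  by (auto simp: bounded_clinear_diag intro!: suminf_nonneg summable_comparison_test'[OF
      summable_coord, where N = 0])

lemma coord_sum: "coord (sum f A) n = (\<Sum>x\<in>A. coord (f x) n)"
  by (induction A rule: infinite_finite_induct) (simp_all add: zero_ell2.rep_eq plus_ell2.rep_eq)

lemma diag_diag: "diag P (diag Q x) = diag (\<lambda>n. P n \<and> Q n) x"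
  by transfer auto

lemma sum_diag: "(\<Sum>l\<in>UNIV. diag (\<lambda>n. g n = (l :: 'n::finite)) x) = x"
  unfolding coord_inject[symmetric] by (rule ext) (simp add: coord_sum diag.rep_eq)

text \<open>Shared randomness as a state: each vertex of the hull occupies one coordinate of
  \<open>ell2\<close>, the state has the square roots of the weights as coordinates, and both
  players measure with the same diagonal projections, which read off the answer of the
  permutation.\<close>

lemma classical_subset_quantum:
  "(classical_correlations :: 'n::finite corr set) \<subseteq> quantum_correlations TYPE(ell2)"
proof
  fix p :: "'n corr" assume p: "p \<in> classical_correlations"
  define X :: "'n corr set" where "X = {perm_corr \<pi> | \<pi>. \<pi> permutes UNIV}"
  have fin: "finite X"
    unfolding X_def using finite_permutations[OF finite, of UNIV] by simp
  obtain w where w: "\<And>x. x \<in> X \<Longrightarrow> 0 \<le> w x" "sum w X = 1" "p = (\<Sum>x\<in>X. w x *\<^sub>R x)"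
    using p unfolding classical_correlations_def X_def[symmetric] convex_hull_finite[OF fin] by auto
  have "\<exists>\<pi>. \<pi> permutes UNIV \<and> x = perm_corr \<pi>" if "x \<in> X" for x using that by (auto simp: X_def)
  then obtain f where f: "\<And>x. x \<in> X \<Longrightarrow> f x permutes UNIV" "\<And>x. x \<in> X \<Longrightarrow> x = perm_corr (f x)"
    by metis
  have p_eq: "p $ (l, k, i, j) = (\<Sum>x\<in>X. if f x i = l \<and> f x j = k then w x else 0)" for l k i j
  proof -
    have "p $ (l, k, i, j) = (\<Sum>x\<in>X. w x * perm_corr (f x) $ (l, k, i, j))"
      unfolding w(3) sum_component using f(2) by (intro sum.cong) simp_all
    then show ?thesis by (auto simp: perm_corr_def intro!: sum.cong)
  qed
  obtain h where h: "bij_betw h {..<card X} X"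
    using ex_bij_betw_nat_finite[OF fin] by (auto simp: lessThan_atLeast0)
  have sum_h: "(\<Sum>n. if n < card X then F (h n) else 0) = (\<Sum>x\<in>X. F x)" for F :: "'n corr \<Rightarrow> real"
    by (subst suminf_finite[of "{..<card X}"]) (auto simp: sum.reindex_bij_betw[OF h])
  define c where "c n = (if n < card X then complex_of_real (sqrt (w (h n))) else 0)" for n
  have "summable (\<lambda>n. (cmod (c n))\<^sup>2)"
    by (rule summable_finite[of "{..<card X}"]) (auto simp: c_def)
  then have coord: "coord (Abs_ell2 c) = c" by (simp add: Abs_ell2_inverse)
  have c: "(cmod (c n))\<^sup>2 = (if n < card X then w (h n) else 0)" for n
    using w(1) bij_betwE[OF h] by (auto simp: c_def)
  \<comment> \<open>For \<open>n\<close> from \<open>card X\<close> on, the value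
    \<open>f (h n)\<close> is arbitrary, but it still assigns exactly one answer to each question,
    so the projections sum to the identity; the state vanishes at these coordinates.\<close>
  define P where "P i l = diag (\<lambda>n. f (h n) i = l)" for i l
  have "norm (Abs_ell2 c) = 1"
    by (simp add: norm_ell2_eq coord c sum_h w(2))
  moreover have "complex_of_real (p $ (l, k, i, j)) = cinner (Abs_ell2 c) (P i l (P j k (Abs_ell2
      c)))" for l k i j
  proof -
    have "(\<Sum>n. if f (h n) i = l \<and> f (h n) j = k then (cmod (c n))\<^sup>2 else 0)
      = (\<Sum>n. if n < card X then if f (h n) i = l \<and> f (h n) j = k then w (h n) else 0 else 0)"
      by (rule suminf_cong) (simp add: c)
    then show ?thesis
      unfolding P_def diag_diag cinner_diag coord p_eq
      by (simp only: sum_h[of "\<lambda>x. if f x i = l \<and> f x j = k then w x else 0"])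
  qed
  moreover have "correlation p"
    unfolding correlation_def
  proof (intro conjI allI)
    fix l k i j
    show "0 \<le> p $ (l, k, i, j)" unfolding p_eq by (rule sum_nonneg) (simp add: w(1))
    have "p $ (l, k, i, j) \<le> sum w X" unfolding p_eq by (rule sum_mono) (simp add: w(1))
    then show "p $ (l, k, i, j) \<le> 1" by (simp add: w(2))
  next
    fix i j
    have "(\<Sum>l\<in>UNIV. \<Sum>k\<in>UNIV. p $ (l, k, i, j)) = (\<Sum>x\<in>X. \<Sum>l\<in>UNIV. \<Sum>k\<in>UNIV.
        if f x i = l \<and> f x j = k then w x else 0)"
      unfolding p_eq by (subst sum.swap[of _ X], subst sum.swap[of _ X]) (rule refl)
    also have "\<dots> = sum w X"
    proof (rule sum.cong[OF refl])
      fix x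
      have "(\<Sum>k\<in>UNIV. if f x i = l \<and> f x j = k then w x else 0) = (if f x i = l then w x else 0)"
          for l
        by auto
      then show "(\<Sum>l\<in>UNIV. \<Sum>k\<in>UNIV. if f x i = l \<and> f x j = k then w x else 0) = w x" by simp
    qed
    finally show "(\<Sum>l\<in>UNIV. \<Sum>k\<in>UNIV. p $ (l, k, i, j)) = 1" by (simp add: w(2))
  qed
  moreover have "winning p"
    unfolding winning_def p_eq
  proof (intro allI impI sum.neutral ballI)
    fix l k i j :: 'n and x assume "(i = j) \<noteq> (l = k)" "x \<in> X"
    moreover have "f x i = f x j \<longleftrightarrow> i = j" using permutes_inj[OF f(1)[OF \<open>x \<in> X\<close>]]
        by (simp add: inj_eq)
    ultimately show "(if f x i = l \<and> f x j = k then w x else 0) = 0" by auto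
  qed
  moreover have "positive_operator (P i l)" "(\<Sum>l\<in>UNIV. P i l x) = x"
      "P i l \<circ> P j k = P j k \<circ> P i l" for i j k l x
    unfolding P_def by (auto simp: positive_operator_diag sum_diag diag_diag conj_commute
        fun_eq_iff)
  ultimately show "p \<in> quantum_correlations TYPE(ell2)"
    unfolding quantum_correlations_def by blast
qed

text \<open>The first part, for an arbitrary Hilbert space type, bounds every member of the union
  defining Q(4) by L(4); the second shows that the single space \<open>ell2\<close> already attains
  L(4).\<close>

theorem theorem3p13:
  shows "quantum_correlations TYPE('h::chilbert_space) \<subseteq> (classical_correlations :: 4 corr set) \<and>
         quantum_correlations TYPE(ell2) = (classical_correlations :: 4 corr set)"
  by (intro conjI equalityI quantum_subset_classical classical_subset_quantum)

end
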